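(* Let $\tau$ be a W-topology on a field $K$, and let $\tau_1,\ldots,\tau_n$ be the local components of $\tau$. Then $\tau$ is an independent sum of $\tau_1,\ldots,\tau_n$; that is, the diagonal map $(K,\tau)\to(K,\tau_1)\times\cdots\times(K,\tau_n)$ is a homeomorphism onto its image, and its image is dense.
   Context: Let $K$ be a field. A topology on $K$ here always means a Hausdorff, non-discrete, locally bounded ring topology on $K$ (a set $B\subseteq K$ is bounded if for every neighborhood $U$ of $0$ there is a neighborhood $V$ of $0$ with $V\cdot B\subseteq U$; locally bounded means some neighborhood of $0$ is bounded). A subset $S\subseteq K$ is a $W_n$-set if for all $x_0,\ldots,x_n\in K$ there is $i$ with $x_i\in\sum_{j\neq i}S\cdot x_j=\{\sum_{j\ne i}s_jx_j : s_j\in S\}$. A topology $\tau$ is a $W_n$-topology if some $\tau$-bounded set is a $W_n$-set; a W-topology is a $W_n$-topology for some finite $n$. Let $K^*$ be a monster model (sufficiently saturated and homogeneous elementary extension) of the theory of $K$ expanded by a unary predicate for every subset of $K$; for $U\subseteq K$, $U^*$ is the interpretation in $K^*$ of the predicate for $U$. For a topology $\tau$ let $R_\tau=\bigcup\{B^* : B\subseteq K\ \tau\text{-bounded}\}$, a subring of $K^*$. If $\tau$ is a W-topology, $R_\tau$ has finitely many maximal ideals, and each localization of $R_\tau$ at a maximal ideal equals $R_\sigma$ for a unique W-topology $\sigma$ on $K$; the local components of $\tau$ are the W-topologies $\tau_1,\ldots,\tau_n$ such that $R_{\tau_1},\ldots,R_{\tau_n}$ are exactly the localizations of $R_\tau$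 at its maximal ideals. *)

theory Defs
  imports "HOL-Analysis.Analysis" "HOL-Library.Equipollence" "HOL-Algebra.Ideal"
begin

section \<open>Topologies on a field\<close>

definition nbhd_zero :: "'a::zero topology \<Rightarrow> 'a set \<Rightarrow> bool" where
  "nbhd_zero \<tau> U \<longleftrightarrow> (\<exists>W. openin \<tau> W \<and> 0 \<in> W \<and> W \<subseteq> U)"

definition ring_topology :: "'a::field topology \<Rightarrow> bool" where
  "ring_topology \<tau> \<longleftrightarrow> topspace \<tau> = UNIV
     \<and> continuous_map (prod_topology \<tau> \<tau>) \<tau> (\<lambda>(x, y). x + y)
     \<and> continuous_map \<tau> \<tau> uminus
     \<and> continuous_map (prod_topology \<tau> \<tau>) \<tau> (\<lambda>(x, y). x * y)"

definition top_bounded :: "'a::field topology \<Rightarrow> 'a set \<Rightarrow> bool" where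
  "top_bounded \<tau> B \<longleftrightarrow>
     (\<forall>U. nbhd_zero \<tau> U \<longrightarrow> (\<exists>V. nbhd_zero \<tau> V \<and> {v * b |v b. v \<in> V \<and> b \<in> B} \<subseteq> U))"

definition locally_bounded :: "'a::field topology \<Rightarrow> bool" where
  "locally_bounded \<tau> \<longleftrightarrow> (\<exists>U. nbhd_zero \<tau> U \<and> top_bounded \<tau> U)"

definition field_topology :: "'a::field topology \<Rightarrow> bool" where
  "field_topology \<tau> \<longleftrightarrow> ring_topology \<tau> \<and> Hausdorff_space \<tau>
     \<and> \<tau> \<noteq> discrete_topology UNIV \<and> locally_bounded \<tau>"

definition W_set :: "nat \<Rightarrow> 'a::field set \<Rightarrow> bool" where
  "W_set n S \<longleftrightarrow> (\<forall>x :: nat \<Rightarrow> 'a. \<exists>i\<le>n.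
     x i \<in> {(\<Sum>j\<in>{..n} - {i}. s j * x j) |s. \<forall>j\<in>{..n} - {i}. s j \<in> S})"

definition Wn_topology :: "nat \<Rightarrow> 'a::field topology \<Rightarrow> bool" where
  "Wn_topology n \<tau> \<longleftrightarrow> field_topology \<tau> \<and> (\<exists>S. top_bounded \<tau> S \<and> W_set n S)"

definition W_topology :: "'a::field topology \<Rightarrow> bool" where
  "W_topology \<tau> \<longleftrightarrow> (\<exists>n. Wn_topology n \<tau>)"


section \<open>Rings expanded by unary predicates, and monster models\<close>

datatype rterm = Var nat | Zero | One | Minus rterm | Plus rterm rterm | Times rterm rterm

datatype 'p form =
    Equal rterm rterm
  | Pred 'p rterm
  | Neg "'p form"
  | Conj "'p form" "'p form"
  | Exists nat "'p form"

primrec rterm_val :: "(nat \<Rightarrow> 'b::field) \<Rightarrow> rterm \<Rightarrow> 'b" where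
  "rterm_val e (Var k) = e k"
| "rterm_val e Zero = 0"
| "rterm_val e One = 1"
| "rterm_val e (Minus t) = - rterm_val e t"
| "rterm_val e (Plus t u) = rterm_val e t + rterm_val e u"
| "rterm_val e (Times t u) = rterm_val e t * rterm_val e u"

text \<open>The first argument interprets the predicate symbols.\<close>

primrec sat :: "('p \<Rightarrow> 'b::field set) \<Rightarrow> (nat \<Rightarrow> 'b) \<Rightarrow> 'p form \<Rightarrow> bool" where
  "sat I e (Equal t u) \<longleftrightarrow> rterm_val e t = rterm_val e u"
| "sat I e (Pred P t) \<longleftrightarrow> rterm_val e t \<in> I P"
| "sat I e (Neg \<phi>) \<longleftrightarrow> \<not> sat I e \<phi>"
| "sat I e (Conj \<phi> \<psi>) \<longleftrightarrow> sat I e \<phi> \<and> sat I e \<psi>"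
| "sat I e (Exists k \<phi>) \<longleftrightarrow> (\<exists>x. sat I (e(k := x)) \<phi>)"

text \<open>
  The predicate symbols are the subsets of the small field \<open>'a\<close>, each interpreted there by
  itself. In the extension \<open>'b\<close> the symbol \<open>U\<close> is interpreted by \<open>star U\<close>, and \<open>\<iota>\<close> is the inclusion.
\<close>

definition elementary_extension ::
    "('a::field \<Rightarrow> 'b::field) \<Rightarrow> ('a set \<Rightarrow> 'b set) \<Rightarrow> bool" where
  "elementary_extension \<iota> star \<longleftrightarrow>
     (\<forall>e (\<phi> :: 'a set form). sat (\<lambda>U. U) e \<phi> \<longleftrightarrow> sat star (\<iota> \<circ> e) \<phi>)"

text \<open>
  A formula with parameters from \<open>A\<close> is a pair of a formula and an assignment with values in
  \<open>A\<close>; the variable \<open>0\<close> is the one to be realised.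
  ``Small'' means of cardinality at most \<open>2 ^ |K|\<close>, the cardinality of the language, so this is
  \<open>\<kappa>\<close>-saturation for the successor \<open>\<kappa>\<close> of that cardinal.
\<close>

definition saturated :: "('a set \<Rightarrow> 'b::field set) \<Rightarrow> bool" where
  "saturated star \<longleftrightarrow>
     (\<forall>A (p :: ('a set form \<times> (nat \<Rightarrow> 'b)) set).
        A \<lesssim> (UNIV :: 'a set set) \<and> (\<forall>(\<phi>, e)\<in>p. range e \<subseteq> A)
        \<and> (\<forall>q\<subseteq>p. finite q \<longrightarrow> (\<exists>x. \<forall>(\<phi>, e)\<in>q. sat star (e(0 := x)) \<phi>))
        \<longrightarrow> (\<exists>x. \<forall>(\<phi>, e)\<in>p. sat star (e(0 := x)) \<phi>))"

definition automorphism :: "('a set \<Rightarrow> 'b::field set) \<Rightarrow> ('b \<Rightarrow> 'b) \<Rightarrow> bool" where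
  "automorphism star g \<longleftrightarrow> bij g
     \<and> (\<forall>x y. g (x + y) = g x + g y) \<and> (\<forall>x y. g (x * y) = g x * g y)
     \<and> (\<forall>U x. g x \<in> star U \<longleftrightarrow> x \<in> star U)"

definition strongly_homogeneous :: "('a set \<Rightarrow> 'b::field set) \<Rightarrow> bool" where
  "strongly_homogeneous star \<longleftrightarrow>
     (\<forall>A f. A \<lesssim> (UNIV :: 'a set set)
        \<and> (\<forall>e (\<phi> :: 'a set form). range e \<subseteq> A \<longrightarrow> (sat star e \<phi> \<longleftrightarrow> sat star (f \<circ> e) \<phi>))
        \<longrightarrow> (\<exists>g. automorphism star g \<and> (\<forall>a\<in>A. g a = f a)))"

definition monster_model :: "('a::field \<Rightarrow> 'b::field) \<Rightarrow> ('a set \<Rightarrow> 'b set) \<Rightarrow> bool" where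
  "monster_model \<iota> star \<longleftrightarrow>
     elementary_extension \<iota> star \<and> saturated star \<and> strongly_homogeneous star"


section \<open>Local components and independent sums\<close>

definition R_top :: "('a::field set \<Rightarrow> 'b::field set) \<Rightarrow> 'a topology \<Rightarrow> 'b set" where
  "R_top star \<tau> = \<Union> {star B |B. top_bounded \<tau> B}"

definition subring_of :: "'b::field set \<Rightarrow> 'b ring" where
  "subring_of R = \<lparr>carrier = R, monoid.mult = (*), one = 1, ring.zero = 0, add = (+)\<rparr>"

text \<open>The localization of a subring of a field at a prime ideal, formed inside that field.\<close>

definition localization :: "'b::field set \<Rightarrow> 'b set \<Rightarrow> 'b set" where
  "localization R M = {a / s |a s. a \<in> R \<and> s \<in> R - M}"

text \<open>
  \<open>T\<close> lists the local components without repetition, indexed by \<open>0, \<dots>, n - 1\<close>.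
\<close>

definition local_components ::
    "('a::field set \<Rightarrow> 'b::field set) \<Rightarrow> 'a topology \<Rightarrow> nat \<Rightarrow> (nat \<Rightarrow> 'a topology) \<Rightarrow> bool" where
  "local_components star \<tau> n T \<longleftrightarrow>
     inj_on T {..<n} \<and> (\<forall>i<n. W_topology (T i))
     \<and> {R_top star (T i) |i. i < n}
       = {localization (R_top star \<tau>) M |M. maximalideal M (subring_of (R_top star \<tau>))}"

definition diagonal :: "nat \<Rightarrow> 'a \<Rightarrow> nat \<Rightarrow> 'a" where
  "diagonal n x = (\<lambda>i\<in>{..<n}. x)"

definition independent_sum :: "'a topology \<Rightarrow> nat \<Rightarrow> (nat \<Rightarrow> 'a topology) \<Rightarrow> bool" where
  "independent_sum \<tau> n T \<longleftrightarrow>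
     embedding_map \<tau> (product_topology T {..<n}) (diagonal n)
     \<and> product_topology T {..<n} closure_of (diagonal n ` topspace \<tau>)
       = topspace (product_topology T {..<n})"

end

theory Submission imports Defs begin

text \<open>
  Saturation yields \<open>\<epsilon> \<noteq> 0\<close> with \<open>\<epsilon> R \<subseteq> U*\<close> for every neighbourhood \<open>U\<close> of zero, where
  \<open>R = R_\<tau>\<close>. Hence \<open>V\<close> is a neighbourhood of zero iff \<open>V*\<close> contains a nonzero multiple of \<open>R\<close>, and
  \<open>\<tau>\<close> is the join of its local components because \<open>R\<close> is the intersection of its localizations
  \<open>R_M\<close>. Density is a Chinese remainder argument for the ideals \<open>R \<inter> e_i R_{M_i}\<close>, which works as
  soon as \<open>R_M R_N = K*\<close> for \<open>M \<noteq> N\<close>.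

  Suppose \<open>A = R_M R_N\<close> is not \<open>K*\<close>. For a nonzero non-unit \<open>e\<close> of \<open>A\<close> the ring \<open>R_M + e A\<close> does not
  contain \<open>A\<close>. Since \<open>R_M\<close> and \<open>A\<close> are unions of \<open>K\<close>-multiples of sets \<open>U*\<close> and \<open>C*\<close>, an inclusion
  \<open>d C* \<subseteq> U* + e C*\<close> valid for all \<open>e \<noteq> 0\<close> would descend to some \<open>d\<close> in \<open>K\<close>. So for every
  \<open>d \<noteq> 0\<close> there is \<open>e \<noteq> 0\<close> with \<open>d A\<close> not contained in \<open>R_M + e A\<close>. This gives families of any length
  in which no member is an \<open>R_M\<close>-combination of the others, contradicting the W-property.
\<close>


section \<open>Locally bounded field topologies\<close>

lemma nbhd_zeroE:
  assumes "nbhd_zero \<tau> U"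
  obtains W where "openin \<tau> W" "0 \<in> W" "W \<subseteq> U"
  using assms unfolding nbhd_zero_def by blast

lemma nbhd_zero_mono: "nbhd_zero \<tau> U \<Longrightarrow> U \<subseteq> V \<Longrightarrow> nbhd_zero \<tau> V"
  unfolding nbhd_zero_def by blast

lemma nbhd_zero_Int: "nbhd_zero \<tau> U \<Longrightarrow> nbhd_zero \<tau> V \<Longrightarrow> nbhd_zero \<tau> (U \<inter> V)"
  unfolding nbhd_zero_def by (metis IntI Int_mono openin_Int)

locale field_top =
  fixes \<tau> :: "'a::field topology"
  assumes field_top: "field_topology \<tau>"
begin

lemma topspace_UNIV: "topspace \<tau> = UNIV"
  using field_top unfolding field_topology_def ring_topology_def by blast

lemma cont_add: "continuous_map (prod_topology \<tau> \<tau>) \<tau> (\<lambda>(x, y). x + y)"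
  and cont_mult: "continuous_map (prod_topology \<tau> \<tau>) \<tau> (\<lambda>(x, y). x * y)"
  using field_top unfolding field_topology_def ring_topology_def by blast+

lemma continuous_translation: "continuous_map \<tau> \<tau> (\<lambda>x. a + x)"
proof -
  have "continuous_map \<tau> (prod_topology \<tau> \<tau>) (\<lambda>x. (a, x))"
    by (simp add: continuous_map_pairedI topspace_UNIV)
  from continuous_map_compose[OF this cont_add] show ?thesis by (simp add: o_def)
qed

lemma continuous_scaling: "continuous_map \<tau> \<tau> (\<lambda>x. a * x)"
proof -
  have "continuous_map \<tau> (prod_topology \<tau> \<tau>) (\<lambda>x. (a, x))"
    by (simp add: continuous_map_pairedI topspace_UNIV)
  from continuous_map_compose[OF this cont_mult] show ?thesis by (simp add: o_def)
qed

lemma openin_translation: "openin \<tau> W \<Longrightarrow> openin \<tau> {x. a + x \<in> W}"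
  using openin_continuous_map_preimage[OF continuous_translation[of a]] topspace_UNIV by auto

lemma openin_scaling: "openin \<tau> W \<Longrightarrow> openin \<tau> {x. a * x \<in> W}"
  using openin_continuous_map_preimage[OF continuous_scaling[of a]] topspace_UNIV by auto

text \<open>Translations are homeomorphisms, so the neighbourhoods of zero determine the topology.
  This is what lets topologies be compared through \<open>nbhd_zero\<close>.\<close>

lemma openin_iff_nbhd: "openin \<tau> W \<longleftrightarrow> (\<forall>x\<in>W. nbhd_zero \<tau> {y. x + y \<in> W})"
proof
  assume "openin \<tau> W"
  then show "\<forall>x\<in>W. nbhd_zero \<tau> {y. x + y \<in> W}"
    unfolding nbhd_zero_def by (metis (no_types, lifting) add.right_neutral mem_Collect_eq openin_translation subset_refl)
next
  assume R: "\<forall>x\<in>W. nbhd_zero \<tau> {y. x + y \<in> W}"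
  show "openin \<tau> W"
  proof (subst openin_subopen, intro ballI)
    fix x assume "x \<in> W"
    then obtain V where V: "openin \<tau> V" "0 \<in> V" "V \<subseteq> {y. x + y \<in> W}"
      using R nbhd_zeroE by meson
    have "openin \<tau> {y. -x + y \<in> V}" using V openin_translation by blast
    moreover have "{y. -x + y \<in> V} \<subseteq> W"
    proof
      fix y assume "y \<in> {y. -x + y \<in> V}"
      then have "x + (-x + y) \<in> W" using V(3) by blast
      then show "y \<in> W" by simp
    qed
    ultimately show "\<exists>T. openin \<tau> T \<and> x \<in> T \<and> T \<subseteq> W"
      using V(2) by (intro exI[of _ "{y. -x + y \<in> V}"]) simp
  qed
qed

lemma nbhd_zero_scale: "nbhd_zero \<tau> U \<Longrightarrow> nbhd_zero \<tau> {x. a * x \<in> U}"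
  unfolding nbhd_zero_def using openin_scaling[of _ a]
  by (metis (mono_tags, lifting) mem_Collect_eq mult_zero_right subsetD subsetI)

lemma nbhd_zero_add:
  assumes "nbhd_zero \<tau> U"
  obtains V where "nbhd_zero \<tau> V" "\<forall>x\<in>V. \<forall>y\<in>V. x + y \<in> U"
proof -
  obtain W where W: "openin \<tau> W" "0 \<in> W" "W \<subseteq> U" using assms nbhd_zeroE by blast
  have op: "openin (prod_topology \<tau> \<tau>) {p. (case p of (x, y) \<Rightarrow> x + y) \<in> W}"
    using openin_continuous_map_preimage[OF cont_add W(1)] topspace_UNIV by simp
  have "(0, 0) \<in> {p. (case p of (x, y) \<Rightarrow> x + y) \<in> W}" using W by simp
  then obtain A B where AB: "openin \<tau> A" "openin \<tau> B" "0 \<in> A" "0 \<in> B"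
      "A \<times> B \<subseteq> {p. (case p of (x, y) \<Rightarrow> x + y) \<in> W}"
    using op unfolding openin_prod_topology_alt by meson
  show ?thesis
  proof (rule that[of "A \<inter> B"])
    show "nbhd_zero \<tau> (A \<inter> B)" unfolding nbhd_zero_def using AB by blast
    show "\<forall>x\<in>A \<inter> B. \<forall>y\<in>A \<inter> B. x + y \<in> U" using AB(5) W(3) by auto
  qed
qed

lemma nbhd_zero_nonzero:
  assumes "nbhd_zero \<tau> U"
  obtains x where "x \<in> U" "x \<noteq> 0"
proof (rule ccontr)
  assume "\<not> thesis"
  then have "U \<subseteq> {0}" using that by blast
  then have n: "nbhd_zero \<tau> {0}" using assms nbhd_zero_mono by blast
  \<comment> \<open>If \<open>{0}\<close> is a neighbourhood of zero, translation makes every set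
    open, against non-discreteness.\<close>
  have "openin \<tau> W" for W
    unfolding openin_iff_nbhd using n by (auto elim: nbhd_zero_mono)
  then have "\<tau> = discrete_topology UNIV"
    by (simp add: topology_eq)
  then show False using field_top unfolding field_topology_def by blast
qed

section \<open>Bounded sets\<close>

lemma bounded_iff:
  "top_bounded \<tau> B \<longleftrightarrow>
    (\<forall>U. nbhd_zero \<tau> U \<longrightarrow> (\<exists>V. nbhd_zero \<tau> V \<and> (\<forall>v\<in>V. \<forall>b\<in>B. v * b \<in> U)))"
proof -
  have "{v * b |v b. v \<in> V \<and> b \<in> B} \<subseteq> U \<longleftrightarrow> (\<forall>v\<in>V. \<forall>b\<in>B. v * b \<in> U)" for U V
    by blast
  then show ?thesis unfolding top_bounded_def by presburger
qed

lemma boundedD: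
  assumes "top_bounded \<tau> B" "nbhd_zero \<tau> U"
  obtains V where "nbhd_zero \<tau> V" "\<forall>v\<in>V. \<forall>b\<in>B. v * b \<in> U"
  using assms unfolding bounded_iff by blast

lemma boundedI:
  assumes "\<And>U. nbhd_zero \<tau> U \<Longrightarrow> \<exists>V. nbhd_zero \<tau> V \<and> (\<forall>v\<in>V. \<forall>b\<in>B. v * b \<in> U)"
  shows "top_bounded \<tau> B"
  unfolding bounded_iff using assms by blast

lemma bounded_singleton: "top_bounded \<tau> {a}"
proof (rule boundedI)
  fix U assume "nbhd_zero \<tau> U"
  then show "\<exists>V. nbhd_zero \<tau> V \<and> (\<forall>v\<in>V. \<forall>b\<in>{a}. v * b \<in> U)"
    by (intro exI[of _ "{x. a * x \<in> U}"]) (simp add: nbhd_zero_scale mult.commute[of _ a])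
qed

lemma bounded_sums:
  assumes "top_bounded \<tau> B" "top_bounded \<tau> C"
  shows "top_bounded \<tau> {b + c |b c. b \<in> B \<and> c \<in> C}"
proof (rule boundedI)
  fix U assume U: "nbhd_zero \<tau> U"
  obtain V where V: "nbhd_zero \<tau> V" "\<forall>x\<in>V. \<forall>y\<in>V. x + y \<in> U"
    by (rule nbhd_zero_add[OF U])
  obtain V1 where V1: "nbhd_zero \<tau> V1" "\<forall>v\<in>V1. \<forall>b\<in>B. v * b \<in> V"
    by (rule boundedD[OF assms(1) V(1)])
  obtain V2 where V2: "nbhd_zero \<tau> V2" "\<forall>v\<in>V2. \<forall>b\<in>C. v * b \<in> V"
    by (rule boundedD[OF assms(2) V(1)])
  show "\<exists>V. nbhd_zero \<tau> V \<and> (\<forall>v\<in>V. \<forall>b\<in>{b + c |b c. b \<in> B \<and> c \<in> C}. v * b \<in> U)"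
    by (rule exI[of _ "V1 \<inter> V2"])
      (use V(2) V1 V2 nbhd_zero_Int in \<open>auto simp: distrib_left\<close>)
qed

lemma bounded_products:
  assumes "top_bounded \<tau> B" "top_bounded \<tau> C"
  shows "top_bounded \<tau> {b * c |b c. b \<in> B \<and> c \<in> C}"
proof (rule boundedI)
  fix U assume U: "nbhd_zero \<tau> U"
  obtain V1 where V1: "nbhd_zero \<tau> V1" "\<forall>v\<in>V1. \<forall>b\<in>C. v * b \<in> U"
    by (rule boundedD[OF assms(2) U])
  obtain V2 where V2: "nbhd_zero \<tau> V2" "\<forall>v\<in>V2. \<forall>b\<in>B. v * b \<in> V1"
    by (rule boundedD[OF assms(1) V1(1)])
  show "\<exists>V. nbhd_zero \<tau> V \<and> (\<forall>v\<in>V. \<forall>b\<in>{b * c |b c. b \<in> B \<and> c \<in> C}. v * b \<in> U)"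
    by (rule exI[of _ V2]) (use V1 V2 in \<open>auto simp: mult.assoc[symmetric]\<close>)
qed

lemma bounded_nbhd:
  obtains U where "nbhd_zero \<tau> U" "top_bounded \<tau> U"
  using field_top unfolding field_topology_def locally_bounded_def by blast

text \<open>Boundedness gives a neighbourhood of zero whose product with \<open>B\<close> lies in
  \<open>U\<close>, and non-discreteness gives it a nonzero element.\<close>

lemma bounded_scale_into:
  assumes "top_bounded \<tau> B" "nbhd_zero \<tau> U"
  obtains c where "c \<noteq> 0" "\<forall>b\<in>B. c * b \<in> U"
proof -
  obtain V where V: "nbhd_zero \<tau> V" "\<forall>v\<in>V. \<forall>b\<in>B. v * b \<in> U"
    by (rule boundedD[OF assms])
  obtain c where "c \<in> V" "c \<noteq> 0" by (rule nbhd_zero_nonzero[OF V(1)])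
  then show ?thesis using V(2) that by blast
qed

lemma nbhd_zero_if_scale:
  assumes "c \<noteq> 0" "nbhd_zero \<tau> U" "\<And>x. x \<in> U \<Longrightarrow> c * x \<in> V"
  shows "nbhd_zero \<tau> V"
proof -
  have "nbhd_zero \<tau> {x. inverse c * x \<in> U}" by (rule nbhd_zero_scale) fact
  moreover have "{x. inverse c * x \<in> U} \<subseteq> V"
  proof
    fix x assume "x \<in> {x. inverse c * x \<in> U}"
    then have "c * (inverse c * x) \<in> V" using assms(3) by blast
    then show "x \<in> V" using assms(1) by (simp add: mult.assoc[symmetric])
  qed
  ultimately show ?thesis using nbhd_zero_mono by blast
qed

end

lemma W_topology_imp_field_topology: "W_topology \<tau> \<Longrightarrow> field_topology \<tau>"
  unfolding W_topology_def Wn_topology_def by blast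


section \<open>Transfer\<close>

abbreviation Forall :: "nat \<Rightarrow> 'p form \<Rightarrow> 'p form" where
  "Forall k \<phi> \<equiv> Neg (Exists k (Neg \<phi>))"

abbreviation Imp :: "'p form \<Rightarrow> 'p form \<Rightarrow> 'p form" where
  "Imp \<phi> \<psi> \<equiv> Neg (Conj \<phi> (Neg \<psi>))"

definition Existss :: "nat list \<Rightarrow> 'p form \<Rightarrow> 'p form" where
  "Existss ks \<phi> = foldr Exists ks \<phi>"

definition Conjs :: "'p form list \<Rightarrow> 'p form" where
  "Conjs \<phi>s = foldr Conj \<phi>s (Equal Zero Zero)"

definition Pluss :: "rterm list \<Rightarrow> rterm" where
  "Pluss ts = foldr Plus ts Zero"

lemma sat_Existss: "sat I e (Existss ks \<phi>) \<longleftrightarrow> (\<exists>f. sat I (override_on e f (set ks)) \<phi>)"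
proof (induction ks arbitrary: e)
  case Nil
  then show ?case by (simp add: Existss_def)
next
  case (Cons k ks)
  have "sat I e (Existss (k # ks) \<phi>) \<longleftrightarrow> (\<exists>x f. sat I (override_on (e(k := x)) f (set ks)) \<phi>)"
    using Cons by (simp add: Existss_def fun_upd_def)
  also have "\<dots> \<longleftrightarrow> (\<exists>f. sat I (override_on e f (insert k (set ks))) \<phi>)"
  proof safe
    fix x f assume "sat I (override_on (e(k := x)) f (set ks)) \<phi>"
    moreover have "override_on (e(k := x)) f (set ks)
        = override_on e (\<lambda>i. if i \<in> set ks then f i else x) (insert k (set ks))"
      by (auto simp: override_on_def)
    ultimately show "\<exists>f. sat I (override_on e f (insert k (set ks))) \<phi>" by metis
  next
    fix f assume "sat I (override_on e f (insert k (set ks))) \<phi>"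
    moreover have "override_on e f (insert k (set ks)) = override_on (e(k := f k)) f (set ks)"
      by (auto simp: override_on_def)
    ultimately show "\<exists>x f. sat I (override_on (e(k := x)) f (set ks)) \<phi>" by metis
  qed
  finally show ?case by simp
qed

lemma sat_Conjs: "sat I e (Conjs \<phi>s) \<longleftrightarrow> (\<forall>\<phi>\<in>set \<phi>s. sat I e \<phi>)"
  unfolding Conjs_def by (induction \<phi>s) auto

lemma rterm_val_Pluss: "rterm_val e (Pluss ts) = sum_list (map (rterm_val e) ts)"
  unfolding Pluss_def by (induction ts) auto

text \<open>Variable \<open>j\<close> stands for \<open>x j\<close> and variable \<open>Suc n + j\<close> for the coefficient \<open>s j\<close>.\<close>

definition not_W_form :: "nat \<Rightarrow> 'p \<Rightarrow> 'p form" where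
  "not_W_form n S = Existss [0..<Suc n] (Conjs (map (\<lambda>i.
     Neg (Existss [Suc n..<Suc n + Suc n] (Conjs (
       Equal (Var i) (Pluss (map (\<lambda>j. Times (Var (Suc n + j)) (Var j)) (filter (\<lambda>j. j \<noteq> i) [0..<Suc n])))
       # map (\<lambda>j. Pred S (Var (Suc n + j))) (filter (\<lambda>j. j \<noteq> i) [0..<Suc n])))))
     [0..<Suc n]))"

text \<open>The negation is encoded because it starts with an existential block for \<open>x\<close>
  and, for each \<open>i\<close>, negates an existential block for \<open>s\<close>; so
  \<open>Existss\<close> and \<open>Conjs\<close> suffice.\<close>

lemma sat_not_W_form: "sat I e (not_W_form n S) \<longleftrightarrow> \<not> W_set n (I S)"
proof -
  define J where "J i = filter (\<lambda>j. j \<noteq> i) [0..<Suc n]" for i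
  have setJ: "set (J i) = {..n} - {i}" and distJ: "distinct (J i)" for i
    unfolding J_def by auto
  have inner: "sat I e' (Existss [Suc n..<Suc n + Suc n] (Conjs (
       Equal (Var i) (Pluss (map (\<lambda>j. Times (Var (Suc n + j)) (Var j)) (J i)))
       # map (\<lambda>j. Pred S (Var (Suc n + j))) (J i))))
     \<longleftrightarrow> (\<exists>s. e' i = (\<Sum>j\<in>{..n} - {i}. s j * e' j) \<and> (\<forall>j\<in>{..n} - {i}. s j \<in> I S))"
    (is "?L \<longleftrightarrow> ?R") if i: "i \<le> n" for i e'
  proof -
    have lo: "override_on e' g {Suc n..<Suc n + Suc n} j = e' j" if "j \<le> n" for g j
      using that by (simp add: override_on_def)
    have hi: "override_on e' g {Suc n..<Suc n + Suc n} (Suc n + j) = g (Suc n + j)" if "j \<le> n" for g j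
      using that by (simp add: override_on_def)
    have "?L \<longleftrightarrow> (\<exists>g. e' i = (\<Sum>j\<in>{..n} - {i}. g (Suc n + j) * e' j)
        \<and> (\<forall>j\<in>{..n} - {i}. g (Suc n + j) \<in> I S))"
    proof -
      have "sat I (override_on e' g {Suc n..<Suc n + Suc n}) (Conjs (
           Equal (Var i) (Pluss (map (\<lambda>j. Times (Var (Suc n + j)) (Var j)) (J i)))
           # map (\<lambda>j. Pred S (Var (Suc n + j))) (J i)))
        \<longleftrightarrow> e' i = (\<Sum>j\<in>{..n} - {i}. g (Suc n + j) * e' j)
            \<and> (\<forall>j\<in>{..n} - {i}. g (Suc n + j) \<in> I S)" for g
      proof -
        let ?e = "override_on e' g {Suc n..<Suc n + Suc n}"
        have "rterm_val ?e (Pluss (map (\<lambda>j. Times (Var (Suc n + j)) (Var j)) (J i)))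
            = (\<Sum>j\<in>{..n} - {i}. ?e (Suc n + j) * ?e j)"
          by (simp only: rterm_val_Pluss map_map o_def rterm_val.simps
              sum_list_distinct_conv_sum_set[OF distJ] setJ)
        also have "\<dots> = (\<Sum>j\<in>{..n} - {i}. g (Suc n + j) * e' j)"
          by (rule sum.cong[OF refl]) (metis DiffD1 atMost_iff hi lo)
        finally have *: "rterm_val ?e (Pluss (map (\<lambda>j. Times (Var (Suc n + j)) (Var j)) (J i)))
            = (\<Sum>j\<in>{..n} - {i}. g (Suc n + j) * e' j)" .
        have **: "(\<forall>\<phi>\<in>set (map (\<lambda>j. Pred S (Var (Suc n + j))) (J i)). sat I ?e \<phi>)
            \<longleftrightarrow> (\<forall>j\<in>{..n} - {i}. g (Suc n + j) \<in> I S)"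
          using hi by (simp add: setJ)
        show ?thesis
          unfolding sat_Conjs list.set(2) ball_simps(7) sat.simps(1) * ** rterm_val.simps(1) lo[OF i] ..
      qed
      then show ?thesis unfolding sat_Existss set_upt by presburger
    qed
    also have "\<dots> \<longleftrightarrow> ?R"
    proof
      assume ?R
      then obtain s where "e' i = (\<Sum>j\<in>{..n} - {i}. s j * e' j) \<and> (\<forall>j\<in>{..n} - {i}. s j \<in> I S)"
        by blast
      \<comment> \<open>The coefficient \<open>s j\<close> sits at index \<open>Suc n + j\<close>,
        hence the shift by \<open>Suc n\<close>.\<close>
      then show "\<exists>g. e' i = (\<Sum>j\<in>{..n} - {i}. g (Suc n + j) * e' j)
        \<and> (\<forall>j\<in>{..n} - {i}. g (Suc n + j) \<in> I S)"
        by (intro exI[of _ "\<lambda>k. s (k - Suc n)"]) simp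
    qed (elim exE, rule exI, assumption)
    finally show ?thesis .
  qed
  have "sat I e (not_W_form n S) \<longleftrightarrow> (\<exists>f. \<forall>i\<le>n. \<not> (\<exists>s.
      override_on e f {..n} i = (\<Sum>j\<in>{..n} - {i}. s j * override_on e f {..n} j)
      \<and> (\<forall>j\<in>{..n} - {i}. s j \<in> I S)))"
  proof -
    have "set [0..<Suc n] = {..n}" by auto
    moreover have "(\<forall>i\<in>{..n}. P i) \<longleftrightarrow> (\<forall>i\<le>n. P i)" for P by blast
    ultimately show ?thesis
      unfolding not_W_form_def sat_Existss[of I e] sat_Conjs[of I "override_on e _ _"] J_def[symmetric]
      using inner by (simp del: upt_Suc)
  qed
  also have "\<dots> \<longleftrightarrow> (\<exists>f. \<forall>i\<le>n. \<not> (\<exists>s. f i = (\<Sum>j\<in>{..n} - {i}. s j * f j)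
      \<and> (\<forall>j\<in>{..n} - {i}. s j \<in> I S)))"
  proof -
    have "override_on e f {..n} i = f i" if "i \<le> n" for f i
      using that by simp
    moreover have "(\<Sum>j\<in>{..n} - {i}. s j * override_on e f {..n} j) = (\<Sum>j\<in>{..n} - {i}. s j * f j)"
      for s f i by (rule sum.cong) auto
    ultimately show ?thesis by simp
  qed
  also have "\<dots> \<longleftrightarrow> \<not> W_set n (I S)"
    unfolding W_set_def by simp
  finally show ?thesis .
qed

definition products_form :: "'p \<Rightarrow> 'p \<Rightarrow> 'p \<Rightarrow> 'p form" where
  "products_form P B C = Forall 2 (Imp (Pred P (Var 2)) (Exists 0 (Exists 1
     (Conj (Conj (Pred B (Var 0)) (Pred C (Var 1))) (Equal (Var 2) (Times (Var 0) (Var 1)))))))"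

lemma sat_products_form:
  "sat I v (products_form P B C) \<longleftrightarrow> (\<forall>x\<in>I P. \<exists>y\<in>I B. \<exists>z\<in>I C. x = y * z)"
  unfolding products_form_def by (auto simp: Bex_def)

text \<open>Variable \<open>0\<close> stays free for the scalar in front of \<open>C\<close>: it can
  be quantified existentially to descend to the small field, and the formula can then be transferred
  back with the scalar found as a parameter.\<close>

definition approximation_form :: "'p \<Rightarrow> 'p \<Rightarrow> 'p form" where
  "approximation_form B C = Forall 1 (Forall 2 (Imp (Neg (Equal (Var 1) Zero)) (Imp (Pred C (Var 2))
     (Exists 3 (Exists 4 (Conj (Conj (Pred B (Var 3)) (Pred C (Var 4)))
       (Equal (Times (Var 0) (Var 2)) (Plus (Var 3) (Times (Var 1) (Var 4))))))))))"

lemma sat_approximation_form: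
  "sat I v (approximation_form B C) \<longleftrightarrow>
     (\<forall>e x. e \<noteq> 0 \<longrightarrow> x \<in> I C \<longrightarrow> (\<exists>y\<in>I B. \<exists>z\<in>I C. v 0 * x = y + e * z))"
  unfolding approximation_form_def by (auto simp: Bex_def)

section \<open>Transfer between the field and its extension\<close>

locale elementary =
  fixes \<iota> :: "'a::field \<Rightarrow> 'b::field" and star :: "'a set \<Rightarrow> 'b set"
  assumes elementary_extension: "elementary_extension \<iota> star"
begin

lemma transfer: "sat (\<lambda>U. U) e \<phi> \<longleftrightarrow> sat star (\<iota> \<circ> e) \<phi>"
  using elementary_extension unfolding elementary_extension_def by blast

lemma iota_zero [simp]: "\<iota> 0 = 0"
  using transfer[of "\<lambda>_. 0" "Equal (Var 0) Zero"] by simp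

lemma iota_one [simp]: "\<iota> 1 = 1"
  using transfer[of "\<lambda>_. 1" "Equal (Var 0) One"] by simp

lemma iota_mult: "\<iota> (x * y) = \<iota> x * \<iota> y"
  \<comment> \<open>Variable \<open>2\<close> takes the default value \<open>x\<close> of the
    assignment.\<close>
  using transfer[of "(\<lambda>_. x)(0 := x * y, 1 := y)" "Equal (Var 0) (Times (Var 2) (Var 1))"]
  by simp

lemma iota_uminus: "\<iota> (- x) = - \<iota> x"
  using transfer[of "(\<lambda>_. x)(0 := - x)" "Equal (Var 0) (Minus (Var 1))"] by simp

lemma iota_eq_0_iff [simp]: "\<iota> x = 0 \<longleftrightarrow> x = 0"
  using transfer[of "\<lambda>_. x" "Equal (Var 0) Zero"] by simp

lemma iota_inverse: "\<iota> (inverse x) = inverse (\<iota> x)"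
proof (cases "x = 0")
  case False
  then have "\<iota> x * \<iota> (inverse x) = 1" by (simp flip: iota_mult)
  then show ?thesis by (metis inverse_unique)
qed simp

lemma iota_mem_star_iff [simp]: "\<iota> x \<in> star U \<longleftrightarrow> x \<in> U"
  using transfer[of "\<lambda>_. x" "Pred U (Var 0)"] by simp

text \<open>This brings the density argument back from the extension: a common point found there
  yields one in the small field.\<close>

lemma star_nonempty: "x \<in> star U \<Longrightarrow> U \<noteq> {}"
  using transfer[of "\<lambda>_. 0" "Exists 0 (Pred U (Var 0))"] by auto

lemma star_mono: "U \<subseteq> V \<Longrightarrow> star U \<subseteq> star V"
  using transfer[of "\<lambda>_. 0" "Forall 0 (Imp (Pred U (Var 0)) (Pred V (Var 0)))"] by auto

lemma star_Int: "star (U \<inter> V) = star U \<inter> star V"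
proof
  show "star U \<inter> star V \<subseteq> star (U \<inter> V)"
    using transfer[of "\<lambda>_. 0" "Forall 0 (Imp (Pred U (Var 0)) (Imp (Pred V (Var 0)) (Pred (U \<inter> V) (Var 0))))"]
    by auto
qed (simp add: star_mono)

lemma star_UNIV: "star UNIV = UNIV"
  using transfer[of "\<lambda>_. 0" "Forall 0 (Pred UNIV (Var 0))"] by auto

lemma star_INT: "star (\<Inter>i<n. U i) = (\<Inter>i<n. star (U i))" for n :: nat
proof (induction n)
  case 0
  then show ?case by (simp add: star_UNIV)
next
  case (Suc n)
  then show ?case by (simp add: lessThan_Suc star_Int)
qed

lemma star_translate: "star {x. a + x \<in> U} = {x. \<iota> a + x \<in> star U}"
  using transfer[of "\<lambda>_. a" "Forall 0 (Imp (Pred {x. a + x \<in> U} (Var 0)) (Pred U (Plus (Var 1) (Var 0))))"]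
    transfer[of "\<lambda>_. a" "Forall 0 (Imp (Pred U (Plus (Var 1) (Var 0))) (Pred {x. a + x \<in> U} (Var 0)))"]
  by auto

lemma star_sums:
  assumes "x \<in> star B" "y \<in> star C"
  shows "x + y \<in> star {b + c |b c. b \<in> B \<and> c \<in> C}"
  using transfer[of "\<lambda>_. 0" "Forall 0 (Forall 1 (Imp (Pred B (Var 0)) (Imp (Pred C (Var 1))
      (Pred {b + c |b c. b \<in> B \<and> c \<in> C} (Plus (Var 0) (Var 1))))))"] assms by auto

lemma star_products:
  "star {b * c |b c. b \<in> B \<and> c \<in> C} = {x * y |x y. x \<in> star B \<and> y \<in> star C}"
proof -
  define P where "P = {b * c |b c. b \<in> B \<and> c \<in> C}"
  have "\<forall>x\<in>star P. \<exists>y\<in>star B. \<exists>z\<in>star C. x = y * z"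
  proof -
    have "\<forall>x\<in>P. \<exists>y\<in>B. \<exists>z\<in>C. x = y * z" unfolding P_def by blast
    then show ?thesis using transfer[of "\<lambda>_. 0" "products_form P B C"] by (simp add: sat_products_form)
  qed
  moreover have "\<forall>x\<in>star B. \<forall>y\<in>star C. x * y \<in> star P"
    using transfer[of "\<lambda>_. 0" "Forall 0 (Forall 1 (Imp (Pred B (Var 0)) (Imp (Pred C (Var 1))
      (Pred P (Times (Var 0) (Var 1))))))"] by (auto simp: P_def)
  ultimately show ?thesis unfolding P_def by blast
qed

text \<open>That some nonzero scalar carries \<open>C\<close> into \<open>V\<close> is a sentence in
  the predicates for \<open>C\<close> and \<open>V\<close>. So a scalar of the extension, however
  infinitesimal, can be traded for one of the small field.\<close>

lemma scale_into_reflect: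
  assumes "e \<noteq> 0" "\<forall>x\<in>star C. e * x \<in> star V"
  obtains a where "a \<noteq> 0" "\<forall>x\<in>C. a * x \<in> V"
proof -
  have "sat star (\<iota> \<circ> (\<lambda>_. 0)) (Exists 0 (Conj (Neg (Equal (Var 0) Zero))
      (Forall 1 (Imp (Pred C (Var 1)) (Pred V (Times (Var 0) (Var 1)))))))"
    using assms by auto
  then show ?thesis using that by (subst (asm) transfer[symmetric]) auto
qed

lemma common_denominator_star:
  assumes "\<And>x. \<exists>d. d \<noteq> 0 \<and> d \<in> U \<and> d * x \<in> U"
  shows "\<exists>d. d \<noteq> 0 \<and> d \<in> star U \<and> d * x \<in> star U"
  using transfer[of "\<lambda>_. 0" "Forall 0 (Exists 1 (Conj (Neg (Equal (Var 1) Zero))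
    (Conj (Pred U (Var 1)) (Pred U (Times (Var 1) (Var 0))))))"] assms by auto

text \<open>The existence of the scalar descends as in \<open>scale_into_reflect\<close>, and the
  formula for the \<open>c\<close> found is transferred up again. The gain is that
  \<open>\<iota> c\<close> and its inverse lie in \<open>R_top star \<tau>\<close> for every field
  topology \<open>\<tau>\<close>.\<close>

lemma scaled_approximation_reflect:
  assumes "d \<noteq> 0"
    and "\<And>e x. e \<noteq> 0 \<Longrightarrow> x \<in> star C \<Longrightarrow> \<exists>y\<in>star B. \<exists>z\<in>star C. d * x = y + e * z"
  obtains c where "c \<noteq> 0"
    "\<forall>e x. e \<noteq> 0 \<longrightarrow> x \<in> star C \<longrightarrow> (\<exists>y\<in>star B. \<exists>z\<in>star C. \<iota> c * x = y + e * z)"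
proof -
  have "sat star (\<iota> \<circ> (\<lambda>_. 0)) (Exists 0 (Conj (Neg (Equal (Var 0) Zero)) (approximation_form B C)))"
    unfolding sat.simps sat_approximation_form using assms by auto
  then have "sat (\<lambda>U. U) (\<lambda>_. 0) (Exists 0 (Conj (Neg (Equal (Var 0) Zero)) (approximation_form B C)))"
    by (subst transfer)
  then obtain c where "c \<noteq> 0" "sat (\<lambda>U. U) ((\<lambda>_. 0)(0 := c)) (approximation_form B C)" by auto
  then show ?thesis using that unfolding transfer sat_approximation_form by simp
qed

lemma W_set_star: "W_set n S \<longleftrightarrow> W_set n (star S)"
  using transfer[of "\<lambda>_. 0" "not_W_form n S"] by (simp add: sat_not_W_form)

end


section \<open>Subrings of a field and their localizations\<close>

locale field_subring =
  fixes R :: "'b::field set"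
  assumes zero_mem: "0 \<in> R" and one_mem: "1 \<in> R"
    and add_mem: "x \<in> R \<Longrightarrow> y \<in> R \<Longrightarrow> x + y \<in> R"
    and mult_mem: "x \<in> R \<Longrightarrow> y \<in> R \<Longrightarrow> x * y \<in> R"
    and uminus_mem: "x \<in> R \<Longrightarrow> - x \<in> R"
begin

lemma diff_mem: "x \<in> R \<Longrightarrow> y \<in> R \<Longrightarrow> x - y \<in> R"
  using add_mem[of x "- y"] uminus_mem by simp

lemma sum_mem: "(\<And>i. i \<in> I \<Longrightarrow> f i \<in> R) \<Longrightarrow> sum f I \<in> R"
  by (induction I rule: infinite_finite_induct) (auto simp: zero_mem add_mem)

lemma prod_mem: "(\<And>i. i \<in> I \<Longrightarrow> f i \<in> R) \<Longrightarrow> prod f I \<in> R"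
  by (induction I rule: infinite_finite_induct) (auto simp: one_mem mult_mem)

lemma cring_subring_of: "cring (subring_of R)"
proof (rule cringI)
  show "abelian_group (subring_of R)"
  proof (rule abelian_groupI)
    fix x assume "x \<in> carrier (subring_of R)"
    then show "\<exists>y\<in>carrier (subring_of R). y \<oplus>\<^bsub>subring_of R\<^esub> x = \<zero>\<^bsub>subring_of R\<^esub>"
      by (intro bexI[of _ "- x"]) (auto simp: subring_of_def uminus_mem)
  qed (auto simp: subring_of_def zero_mem add_mem)
  show "Group.comm_monoid (subring_of R)"
    by (rule comm_monoidI) (auto simp: subring_of_def one_mem mult_mem)
qed (auto simp: subring_of_def distrib_right)

lemma ideal_subring_of_iff:
  "ideal I (subring_of R) \<longleftrightarrow> I \<subseteq> R \<and> 0 \<in> I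
     \<and> (\<forall>x\<in>I. \<forall>y\<in>I. x + y \<in> I) \<and> (\<forall>r\<in>R. \<forall>x\<in>I. r * x \<in> I)" (is "?L \<longleftrightarrow> ?P")
proof
  assume ?L
  then interpret ideal I "subring_of R" .
  show ?P
    using a_subset additive_subgroup.zero_closed[OF is_additive_subgroup] additive_subgroup.a_closed[OF is_additive_subgroup]
      I_l_closed
    by (auto simp: subring_of_def)
next
  assume P: ?P
  then have P': "\<forall>r\<in>R. \<forall>x\<in>I. x * r \<in> I" by (metis mult.commute)
  interpret cring "subring_of R" by (rule cring_subring_of)
  show ?L
  proof (rule idealI[OF ring_axioms])
    have inv: "\<ominus>\<^bsub>subring_of R\<^esub> x = - x" if "x \<in> R" for x
      by (rule minus_equality) (use that uminus_mem in \<open>auto simp: subring_of_def\<close>)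
    show "subgroup I (add_monoid (subring_of R))"
    proof (rule add.subgroupI)
      fix x assume x: "x \<in> I"
      then have "- 1 * x \<in> I" using P one_mem uminus_mem by blast
      then show "\<ominus>\<^bsub>subring_of R\<^esub> x \<in> I" using inv x P by auto
    qed (use P in \<open>auto simp: subring_of_def\<close>)
  qed (use P P' in \<open>auto simp: subring_of_def\<close>)
qed

lemma maximalideal_subring_of_iff:
  "maximalideal M (subring_of R) \<longleftrightarrow> ideal M (subring_of R) \<and> 1 \<notin> M
     \<and> (\<forall>J. ideal J (subring_of R) \<longrightarrow> M \<subseteq> J \<longrightarrow> 1 \<notin> J \<longrightarrow> J = M)"
proof -
  have top: "1 \<in> J \<longleftrightarrow> J = R" if "ideal J (subring_of R)" for J
    using that one_mem unfolding ideal_subring_of_iff by (metis mult.right_neutral subsetI subset_antisym)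
  have R: "carrier (subring_of R) = R" by (simp add: subring_of_def)
  show ?thesis
    unfolding maximalideal_def maximalideal_axioms_def R
    using top ideal_subring_of_iff by metis
qed

lemma exists_maximalideal:
  assumes "ideal I (subring_of R)" "1 \<notin> I"
  obtains M where "maximalideal M (subring_of R)" "I \<subseteq> M"
proof -
  define \<A> where "\<A> = {J. ideal J (subring_of R) \<and> 1 \<notin> J \<and> I \<subseteq> J}"
  have "\<exists>M\<in>\<A>. \<forall>X\<in>\<A>. M \<subseteq> X \<longrightarrow> X = M"
  proof (rule subset_Zorn_nonempty)
    show "\<A> \<noteq> {}" using assms unfolding \<A>_def by blast
  next
    fix \<C> assume C: "\<C> \<noteq> {}" "subset.chain \<A> \<C>"
    then have CA: "\<C> \<subseteq> \<A>" and ch: "\<And>X Y. X \<in> \<C> \<Longrightarrow> Y \<in> \<C> \<Longrightarrow> X \<subseteq> Y \<or> Y \<subseteq> X"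
      unfolding subset_chain_def by blast+
    have id: "X \<subseteq> R \<and> 0 \<in> X \<and> (\<forall>x\<in>X. \<forall>y\<in>X. x + y \<in> X) \<and> (\<forall>r\<in>R. \<forall>x\<in>X. r * x \<in> X)
        \<and> 1 \<notin> X \<and> I \<subseteq> X" if "X \<in> \<C>" for X
      using CA that unfolding \<A>_def ideal_subring_of_iff by blast
    have "x + y \<in> \<Union>\<C>" if xy: "x \<in> \<Union>\<C>" "y \<in> \<Union>\<C>" for x y
    proof -
      obtain X Y where XY: "X \<in> \<C>" "Y \<in> \<C>" "x \<in> X" "y \<in> Y" using xy by blast
      then obtain Z where "Z \<in> \<C>" "x \<in> Z" "y \<in> Z" using ch[OF XY(1,2)] by blast
      then show ?thesis using id by blast
    qed
    moreover have "\<Union>\<C> \<subseteq> R" using id by blast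
    moreover have "0 \<in> \<Union>\<C>" using id C(1) by blast
    moreover have "r * x \<in> \<Union>\<C>" if "r \<in> R" "x \<in> \<Union>\<C>" for r x using id that by blast
    ultimately have "ideal (\<Union>\<C>) (subring_of R)"
      unfolding ideal_subring_of_iff by blast
    moreover have "1 \<notin> \<Union>\<C>" "I \<subseteq> \<Union>\<C>" using id C(1) by blast+
    ultimately show "\<Union>\<C> \<in> \<A>" unfolding \<A>_def by blast
  qed
  then obtain M where M: "M \<in> \<A>" "\<And>X. X \<in> \<A> \<Longrightarrow> M \<subseteq> X \<Longrightarrow> X = M" by blast
  then have "maximalideal M (subring_of R)"
    unfolding maximalideal_subring_of_iff \<A>_def by blast
  then show ?thesis using that M(1) unfolding \<A>_def by blast
qed

section \<open>Localization at a maximal ideal\<close>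

context
  fixes M assumes M: "maximalideal M (subring_of R)"
begin

lemma maximalideal_subset: "M \<subseteq> R"
  and maximalideal_zero: "0 \<in> M"
  and maximalideal_add: "x \<in> M \<Longrightarrow> y \<in> M \<Longrightarrow> x + y \<in> M"
  and maximalideal_mult: "r \<in> R \<Longrightarrow> x \<in> M \<Longrightarrow> r * x \<in> M"
  and maximalideal_one: "1 \<notin> M"
  using M unfolding maximalideal_subring_of_iff ideal_subring_of_iff by blast+

lemma maximalideal_mult_notin:
  assumes "x \<in> R - M" "y \<in> R - M" shows "x * y \<in> R - M"
proof -
  interpret cring "subring_of R" by (rule cring_subring_of)
  have "primeideal M (subring_of R)" by (rule maximalideal_prime[OF M])
  from primeideal.I_prime[OF this, of x y] show ?thesis
    using assms mult_mem by (auto simp: subring_of_def)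
qed

lemma maximalideal_prod_notin:
  "finite I \<Longrightarrow> (\<And>i. i \<in> I \<Longrightarrow> f i \<in> R - M) \<Longrightarrow> prod f I \<in> R - M"
proof (induction I rule: finite_induct)
  case empty
  then show ?case using one_mem maximalideal_one by simp
next
  case (insert i I)
  then show ?case using maximalideal_mult_notin[of "f i" "prod f I"] by simp
qed

lemma localizationI: "a \<in> R \<Longrightarrow> s \<in> R \<Longrightarrow> s \<notin> M \<Longrightarrow> a / s \<in> localization R M"
  unfolding localization_def by blast

lemma subset_localization: "R \<subseteq> localization R M"
  using localizationI[OF _ one_mem maximalideal_one] by auto

text \<open>If \<open>1 / r = a / s\<close>, then \<open>s = a * r\<close>, so a denominator
  \<open>s\<close> outside \<open>M\<close> forces \<open>r\<close> outside \<open>M\<close>. This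
  lets \<open>M\<close> be recovered from its localization.\<close>

lemma unit_localization_iff:
  assumes "r \<in> R" "r \<noteq> 0"
  shows "1 / r \<in> localization R M \<longleftrightarrow> r \<notin> M"
proof
  assume "1 / r \<in> localization R M"
  then obtain a s where as: "1 / r = a / s" "a \<in> R" "s \<in> R - M"
    unfolding localization_def by blast
  then have "s \<noteq> 0" using maximalideal_zero by auto
  then have "s = a * r" using as(1) assms(2) by (simp add: field_simps)
  then show "r \<notin> M" using as maximalideal_mult by auto
qed (use localizationI[OF one_mem] assms in blast)

end

lemma maximalideal_eq_if_localization_eq:
  assumes M: "maximalideal M (subring_of R)" and N: "maximalideal N (subring_of R)"
    and eq: "localization R M = localization R N"
  shows "M = N"
proof -
  have "r \<in> M \<longleftrightarrow> r \<in> N" if "r \<in> R" for r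
    using unit_localization_iff[OF M that] unit_localization_iff[OF N that] eq
      maximalideal_zero[OF M] maximalideal_zero[OF N] by metis
  then show ?thesis using maximalideal_subset[OF M] maximalideal_subset[OF N] by blast
qed

lemma maximalideal_not_subset:
  assumes M: "maximalideal M (subring_of R)" and N: "maximalideal N (subring_of R)" and "M \<noteq> N"
  obtains t where "t \<in> M" "t \<notin> N"
proof -
  have "ideal N (subring_of R)" "1 \<notin> N" using N unfolding maximalideal_subring_of_iff by blast+
  then have "\<not> M \<subseteq> N" using M assms(3) unfolding maximalideal_subring_of_iff by blast
  then show ?thesis using that by blast
qed

text \<open>The ideal of all \<open>r\<close> in \<open>R\<close> with \<open>r * x\<close> in
  \<open>R\<close> contains, for each maximal \<open>M\<close>, a denominator of \<open>x\<close>
  outside \<open>M\<close>. So no maximal ideal contains it, and it must contain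
  \<open>1\<close>.\<close>

lemma mem_if_mem_localizations:
  assumes "\<And>M. maximalideal M (subring_of R) \<Longrightarrow> x \<in> localization R M"
  shows "x \<in> R"
proof (rule ccontr)
  assume "x \<notin> R"
  define I where "I = {r \<in> R. r * x \<in> R}"
  have "ideal I (subring_of R)"
    unfolding ideal_subring_of_iff I_def using add_mem mult_mem zero_mem
    by (auto simp: distrib_right mult.assoc)
  moreover have "1 \<notin> I" using \<open>x \<notin> R\<close> unfolding I_def by simp
  ultimately obtain M where M: "maximalideal M (subring_of R)" "I \<subseteq> M"
    by (rule exists_maximalideal)
  obtain a s where as: "x = a / s" "a \<in> R" "s \<in> R - M"
    using assms[OF M(1)] unfolding localization_def by blast
  then have "s * x = a" using maximalideal_zero[OF M(1)] by (metis DiffD2 nonzero_mult_div_cancel_left times_divide_eq_right)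
  then have "s \<in> I" unfolding I_def using as by simp
  then show False using as M(2) by blast
qed

text \<open>The ring generated by the two localizations at maximal ideals, written as fractions
  whose denominators multiply elements of the two complements; closure under addition is then a
  common-denominator computation.\<close>

definition double_localization :: "'b set \<Rightarrow> 'b set \<Rightarrow> 'b set" where
  "double_localization M N = {a / (s * t) |a s t. a \<in> R \<and> s \<in> R - M \<and> t \<in> R - N}"

lemma double_localizationE:
  assumes "x \<in> double_localization M N"
  obtains a s t where "a \<in> R" "s \<in> R - M" "t \<in> R - N" "x = a / (s * t)"
  using assms unfolding double_localization_def by blast

context
  fixes M N
  assumes M: "maximalideal M (subring_of R)" and N: "maximalideal N (subring_of R)"
begin

lemma double_localizationI:
  "a \<in> R \<Longrightarrow> s \<in> R - M \<Longrightarrow> t \<in> R - N \<Longrightarrow> a / (s * t) \<in> double_localization M N"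
  unfolding double_localization_def by blast

lemma double_localization_eq_products:
  "double_localization M N = {x * y |x y. x \<in> localization R M \<and> y \<in> localization R N}" (is "?A = ?P")
proof
  show "?A \<subseteq> ?P"
  proof
    fix x assume "x \<in> ?A"
    then obtain a s t where *: "a \<in> R" "s \<in> R - M" "t \<in> R - N" "x = a / (s * t)"
      by (rule double_localizationE)
    then have "x = (a / s) * (1 / t)" by simp
    moreover have "a / s \<in> localization R M" "1 / t \<in> localization R N"
      using * localizationI[OF M] localizationI[OF N one_mem] by blast+
    ultimately show "x \<in> ?P" by blast
  qed
  show "?P \<subseteq> ?A"
  proof
    fix x assume "x \<in> ?P"
    then obtain a s b t where *: "a \<in> R" "s \<in> R - M" "b \<in> R" "t \<in> R - N" "x = (a / s) * (b / t)"
      unfolding localization_def by blast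
    then have "x = (a * b) / (s * t)" by simp
    then show "x \<in> ?A" using double_localizationI * mult_mem by metis
  qed
qed

lemma double_localization_add:
  assumes "x \<in> double_localization M N" "y \<in> double_localization M N"
  shows "x + y \<in> double_localization M N"
proof -
  obtain a s t where x: "a \<in> R" "s \<in> R - M" "t \<in> R - N" "x = a / (s * t)"
    using assms(1) by (rule double_localizationE)
  obtain b u v where y: "b \<in> R" "u \<in> R - M" "v \<in> R - N" "y = b / (u * v)"
    using assms(2) by (rule double_localizationE)
  have "s \<noteq> 0" "t \<noteq> 0" "u \<noteq> 0" "v \<noteq> 0"
    using x y maximalideal_zero[OF M] maximalideal_zero[OF N] by auto
  then have "x + y = (a * (u * v) + b * (s * t)) / ((s * u) * (t * v))"
    using x(4) y(4) by (simp add: field_simps)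
  moreover have "s * u \<in> R - M" "t * v \<in> R - N"
    using maximalideal_mult_notin M N x y by blast+
  moreover have "a * (u * v) + b * (s * t) \<in> R" using x y by (simp add: add_mem mult_mem)
  ultimately show ?thesis using double_localizationI by presburger
qed

lemma double_localization_mult:
  assumes "x \<in> double_localization M N" "y \<in> double_localization M N"
  shows "x * y \<in> double_localization M N"
proof -
  obtain a s t where x: "a \<in> R" "s \<in> R - M" "t \<in> R - N" "x = a / (s * t)"
    using assms(1) by (rule double_localizationE)
  obtain b u v where y: "b \<in> R" "u \<in> R - M" "v \<in> R - N" "y = b / (u * v)"
    using assms(2) by (rule double_localizationE)
  have "x * y = (a * b) / ((s * u) * (t * v))" using x(4) y(4) by (simp add: field_simps)
  moreover have "s * u \<in> R - M" "t * v \<in> R - N"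
    using maximalideal_mult_notin M N x y by blast+
  moreover have "a * b \<in> R" using mult_mem x y by blast
  ultimately show ?thesis using double_localizationI by presburger
qed

text \<open>An element of \<open>M - N\<close> is invertible in the double localization, but cannot become invertible
  modulo the ideal generated by a non-unit \<open>e\<close> of it, because the localization at \<open>M\<close> is local.\<close>

lemma double_localization_not_subset:
  assumes "M \<noteq> N" "e \<noteq> 0" "1 / e \<notin> double_localization M N"
  obtains x where "x \<in> double_localization M N"
    "\<forall>y\<in>localization R M. \<forall>z\<in>double_localization M N. x \<noteq> y + e * z"
proof -
  obtain t where t: "t \<in> M" "t \<notin> N" using maximalideal_not_subset[OF M N assms(1)] by blast
  have tR: "t \<in> R" and t0: "t \<noteq> 0"
    using t maximalideal_subset[OF M] maximalideal_zero[OF N] by auto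
  have unit: "1 / t \<in> double_localization M N"
    using double_localizationI[OF one_mem, of 1 t] one_mem maximalideal_one[OF M] t tR by simp
  moreover have False
    if y: "y \<in> localization R M" and z: "z \<in> double_localization M N" and eq: "1 / t = y + e * z" for y z
  proof -
    obtain u v where uv: "y = u / v" "u \<in> R" "v \<in> R - M" using y unfolding localization_def by blast
    have v0: "v \<noteq> 0" using uv maximalideal_zero[OF M] by auto
    \<comment> \<open>Locality at \<open>M\<close>: \<open>t\<close> lies in \<open>M\<close> and
      \<open>v\<close> does not, so \<open>v - t * u\<close> is again a valid denominator. It will
      be the denominator of \<open>1 / e\<close>.\<close>
    have "v - t * u \<notin> M"
    proof
      assume "v - t * u \<in> M"
      moreover have "t * u \<in> M" using maximalideal_mult[OF M uv(2) t(1)] by (simp add: mult.commute)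
      ultimately have "(v - t * u) + t * u \<in> M" by (rule maximalideal_add[OF M])
      then show False using uv(3) by simp
    qed
    then have w: "v - t * u \<in> R - M" using uv tR diff_mem mult_mem by auto
    then have w0: "v - t * u \<noteq> 0" using maximalideal_zero[OF M] by auto
    have "t * (e * z) * v = v - t * u" using eq uv(1) v0 t0 by (simp add: field_simps)
    then have "1 / e = z * (t * v / (v - t * u))" using w0 assms(2) by (simp add: field_simps)
    moreover have "t * v / ((v - t * u) * 1) \<in> double_localization M N"
      using w uv tR mult_mem one_mem maximalideal_one[OF N] by (intro double_localizationI) auto
    ultimately show False using double_localization_mult[OF z] assms(3) by (metis mult.right_neutral)
  qed
  ultimately show ?thesis using that by blast
qed

end

end


section \<open>The ring of bounded elements\<close>

locale saturated_extension = elementary \<iota> star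
  for \<iota> :: "'a::field \<Rightarrow> 'b::field" and star :: "'a set \<Rightarrow> 'b set" +
  assumes saturated: "saturated star"
begin

lemma star_scale_into: "\<forall>b\<in>B. c * b \<in> U \<Longrightarrow> \<forall>x\<in>star B. \<iota> c * x \<in> star U"
  using transfer[of "\<lambda>_. c" "Forall 0 (Imp (Pred B (Var 0)) (Pred U (Times (Var 1) (Var 0))))"]
  by auto

context
  fixes \<tau> :: "'a topology"
  assumes \<tau>: "field_topology \<tau>"
begin

interpretation field_top \<tau> by unfold_locales (rule \<tau>)

lemma R_topI: "top_bounded \<tau> B \<Longrightarrow> x \<in> star B \<Longrightarrow> x \<in> R_top star \<tau>"
  unfolding R_top_def by blast

lemma R_topE:
  assumes "x \<in> R_top star \<tau>"
  obtains B where "top_bounded \<tau> B" "x \<in> star B"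
  using assms unfolding R_top_def by blast

lemma iota_mem_R_top: "\<iota> c \<in> R_top star \<tau>"
  by (rule R_topI[OF bounded_singleton[of c]]) simp

lemma subring_R_top: "field_subring (R_top star \<tau>)"
proof
  show "0 \<in> R_top star \<tau>" "1 \<in> R_top star \<tau>"
    using iota_mem_R_top[of 0] iota_mem_R_top[of 1] by simp_all
  show mult: "x * y \<in> R_top star \<tau>" if x: "x \<in> R_top star \<tau>" and y: "y \<in> R_top star \<tau>" for x y
  proof -
    obtain B where B: "top_bounded \<tau> B" "x \<in> star B" using x by (rule R_topE)
    obtain C where C: "top_bounded \<tau> C" "y \<in> star C" using y by (rule R_topE)
    have "x * y \<in> star {b * c |b c. b \<in> B \<and> c \<in> C}" using B C star_products by blast
    then show ?thesis using R_topI bounded_products[OF B(1) C(1)] by blast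
  qed
  show "x + y \<in> R_top star \<tau>" if x: "x \<in> R_top star \<tau>" and y: "y \<in> R_top star \<tau>" for x y
  proof -
    obtain B where B: "top_bounded \<tau> B" "x \<in> star B" using x by (rule R_topE)
    obtain C where C: "top_bounded \<tau> C" "y \<in> star C" using y by (rule R_topE)
    show ?thesis using R_topI bounded_sums[OF B(1) C(1)] star_sums[OF B(2) C(2)] by blast
  qed
  show "- x \<in> R_top star \<tau>" if "x \<in> R_top star \<tau>" for x
    using mult[OF iota_mem_R_top[of "- 1"] that] by (simp add: iota_uminus)
qed

text \<open>One bounded neighbourhood describes the whole ring: every bounded set is scaled into
  \<open>U\<close> by a nonzero scalar of the small field, and such scalars are units of the
  ring.\<close>

lemma R_top_iff:
  assumes "nbhd_zero \<tau> U" "top_bounded \<tau> U"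
  shows "x \<in> R_top star \<tau> \<longleftrightarrow> (\<exists>c. c \<noteq> 0 \<and> \<iota> c * x \<in> star U)"
proof
  assume "x \<in> R_top star \<tau>"
  then obtain B where B: "top_bounded \<tau> B" "x \<in> star B" by (rule R_topE)
  obtain c where "c \<noteq> 0" "\<forall>b\<in>B. c * b \<in> U" by (rule bounded_scale_into[OF B(1) assms(1)])
  then show "\<exists>c. c \<noteq> 0 \<and> \<iota> c * x \<in> star U" using star_scale_into B(2) by blast
next
  assume "\<exists>c. c \<noteq> 0 \<and> \<iota> c * x \<in> star U"
  then obtain c where c: "c \<noteq> 0" "\<iota> c * x \<in> star U" by blast
  have "\<iota> (inverse c) * (\<iota> c * x) \<in> R_top star \<tau>"
    using field_subring.mult_mem[OF subring_R_top] iota_mem_R_top R_topI[OF assms(2) c(2)] by blast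
  then show "x \<in> R_top star \<tau>" using c(1) by (simp add: iota_inverse mult.assoc[symmetric])
qed

text \<open>The element realises the type saying that it is nonzero and multiplies
  \<open>star B\<close> into \<open>star U\<close> for every bounded \<open>B\<close>. Finitely many
  of these conditions are met inside the small field.\<close>

lemma infinitesimal:
  assumes U: "nbhd_zero \<tau> U"
  obtains \<epsilon> where "\<epsilon> \<noteq> 0" "\<forall>x\<in>R_top star \<tau>. \<epsilon> * x \<in> star U"
proof -
  define \<phi> where "\<phi> B = Forall 1 (Imp (Pred B (Var 1)) (Pred U (Times (Var 0) (Var 1))))" for B :: "'a set"
  \<comment> \<open>Only variable \<open>0\<close> is free in the formulas of the type, so
    \<open>z\<close> is a dummy assignment and \<open>{0}\<close> serves as the parameter
    set.\<close>
  define z where "z = (\<lambda>_::nat. 0::'b)"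
  define p where "p = insert (Neg (Equal (Var 0) Zero), z) {(\<phi> B, z) |B. top_bounded \<tau> B}"
  define sat_at where "sat_at x f = (case f of (\<phi>, e) \<Rightarrow> sat star (e(0 := x)) \<phi>)"
    for x and f :: "'a set form \<times> (nat \<Rightarrow> 'b)"
  \<comment> \<open>Stronger than one solution, for the sake of the induction: all nonzero points of
    some neighbourhood satisfy \<open>q\<close>, and neighbourhoods can be intersected.\<close>
  have near: "\<exists>V. nbhd_zero \<tau> V \<and> (\<forall>v\<in>V. v \<noteq> 0 \<longrightarrow> (\<forall>f\<in>q. sat_at (\<iota> v) f))"
    if "finite q" "q \<subseteq> p" for q
    using that
  proof (induction q rule: finite_induct)
    case empty
    then show ?case using U by auto
  next
    case (insert f q)
    then obtain V where V: "nbhd_zero \<tau> V"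
        "\<forall>v\<in>V. v \<noteq> 0 \<longrightarrow> (\<forall>f\<in>q. sat_at (\<iota> v) f)"
      by blast
    have "f \<in> p" using insert by blast
    then consider "f = (Neg (Equal (Var 0) Zero), z)" | B where "f = (\<phi> B, z)" "top_bounded \<tau> B"
      unfolding p_def by blast
    then show ?case
    proof cases
      case 1
      then show ?thesis using V by (intro exI[of _ V]) (auto simp: sat_at_def)
    next
      case 2
      obtain V' where V': "nbhd_zero \<tau> V'" "\<forall>v\<in>V'. \<forall>b\<in>B. v * b \<in> U"
        by (rule boundedD[OF 2(2) U])
      have "sat_at (\<iota> v) (\<phi> B, z)" if "v \<in> V'" for v
        using star_scale_into[of B v U] that V'(2) unfolding \<phi>_def z_def sat_at_def by simp
      then show ?thesis
        using V V' 2 nbhd_zero_Int[of \<tau> V V'] by (intro exI[of _ "V \<inter> V'"]) auto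
    qed
  qed
  have "\<exists>x. \<forall>f\<in>p. sat_at x f"
  proof -
    have "{0::'b} \<lesssim> (UNIV :: 'a set set)"
      unfolding lepoll_def by (intro exI[of _ "\<lambda>_. {}"]) auto
    moreover have "\<forall>(\<phi>, e)\<in>p. range e \<subseteq> {0}"
      unfolding p_def z_def by auto
    moreover have "\<exists>x. \<forall>f\<in>q. sat_at x f" if q: "q \<subseteq> p" "finite q" for q
    proof -
      obtain V where V: "nbhd_zero \<tau> V"
          "\<forall>v\<in>V. v \<noteq> 0 \<longrightarrow> (\<forall>f\<in>q. sat_at (\<iota> v) f)"
        using near[OF q(2,1)] by blast
      obtain v where "v \<in> V" "v \<noteq> 0" by (rule nbhd_zero_nonzero[OF V(1)])
      then show ?thesis using V(2) by blast
    qed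
    ultimately show ?thesis using saturated unfolding saturated_def sat_at_def by blast
  qed
  then obtain \<epsilon> where \<epsilon>: "\<forall>f\<in>p. sat_at \<epsilon> f" by blast
  show ?thesis
  proof (rule that)
    show "\<epsilon> \<noteq> 0" using \<epsilon> unfolding p_def sat_at_def by auto
    show "\<forall>x\<in>R_top star \<tau>. \<epsilon> * x \<in> star U"
    proof
      fix x assume "x \<in> R_top star \<tau>"
      then obtain B where B: "top_bounded \<tau> B" "x \<in> star B" by (rule R_topE)
      then have "sat_at \<epsilon> (\<phi> B, z)" using \<epsilon> unfolding p_def by blast
      then show "\<epsilon> * x \<in> star U" using B(2) unfolding \<phi>_def z_def sat_at_def by simp
    qed
  qed
qed

text \<open>One direction is \<open>infinitesimal\<close>. Conversely, \<open>e\<close> multiplies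
  the star of a bounded neighbourhood \<open>U\<close> into \<open>star V\<close>, so it can be
  replaced by a scalar \<open>a\<close> of the small field, and \<open>V\<close> contains the
  neighbourhood \<open>a U\<close>.\<close>

lemma nbhd_zero_iff_R_top: "nbhd_zero \<tau> V \<longleftrightarrow> (\<exists>e. e \<noteq> 0 \<and> (\<forall>x\<in>R_top star \<tau>. e * x \<in> star V))"
proof
  assume "nbhd_zero \<tau> V"
  then show "\<exists>e. e \<noteq> 0 \<and> (\<forall>x\<in>R_top star \<tau>. e * x \<in> star V)" by (rule infinitesimal) blast
next
  assume "\<exists>e. e \<noteq> 0 \<and> (\<forall>x\<in>R_top star \<tau>. e * x \<in> star V)"
  then obtain e where e: "e \<noteq> 0" "\<forall>x\<in>R_top star \<tau>. e * x \<in> star V" by blast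
  obtain U where U: "nbhd_zero \<tau> U" "top_bounded \<tau> U" by (rule bounded_nbhd)
  have "\<forall>x\<in>star U. e * x \<in> star V" using e(2) R_topI[OF U(2)] by blast
  then obtain a where "a \<noteq> 0" "\<forall>x\<in>U. a * x \<in> V" by (rule scale_into_reflect[OF e(1)])
  then show "nbhd_zero \<tau> V" using nbhd_zero_if_scale[OF _ U(1)] by blast
qed

text \<open>The extension is the fraction field of the ring. In the small field, \<open>U\<close>
  and its preimage under multiplication by \<open>x\<close> are neighbourhoods of zero and share a
  nonzero \<open>d\<close>; this transfers.\<close>

lemma common_denominator_R_top: "\<exists>d. d \<noteq> 0 \<and> d \<in> R_top star \<tau> \<and> d * x \<in> R_top star \<tau>"
proof -
  obtain U where U: "nbhd_zero \<tau> U" "top_bounded \<tau> U" by (rule bounded_nbhd)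
  have "\<exists>d. d \<noteq> 0 \<and> d \<in> U \<and> d * x \<in> U" for x
  proof -
    have "nbhd_zero \<tau> (U \<inter> {d. x * d \<in> U})" using U(1) nbhd_zero_scale nbhd_zero_Int by blast
    then obtain d where "d \<in> U \<inter> {d. x * d \<in> U}" "d \<noteq> 0" by (rule nbhd_zero_nonzero)
    then show ?thesis by (auto simp: mult.commute)
  qed
  from common_denominator_star[OF this, of x] show ?thesis using R_topI[OF U(2)] by blast
qed

end

text \<open>The ring determines the neighbourhoods of zero and with them the topology. Hence
  distinct components have distinct rings.\<close>

lemma R_top_inject:
  assumes \<sigma>: "field_topology \<sigma>" and \<tau>: "field_topology \<tau>" and eq: "R_top star \<sigma> = R_top star \<tau>"
  shows "\<sigma> = \<tau>"
proof -
  have "nbhd_zero \<sigma> V \<longleftrightarrow> nbhd_zero \<tau> V" for V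
    using nbhd_zero_iff_R_top[OF \<sigma>] nbhd_zero_iff_R_top[OF \<tau>] eq by simp
  then show ?thesis
    using field_top.openin_iff_nbhd[OF field_top.intro[OF \<sigma>]]
      field_top.openin_iff_nbhd[OF field_top.intro[OF \<tau>]] by (simp add: topology_eq)
qed

lemma W_topology_R_top:
  assumes "W_topology \<tau>"
  obtains n where "\<And>x :: nat \<Rightarrow> 'b. \<exists>i\<le>n. \<exists>s. (\<forall>j\<in>{..n} - {i}. s j \<in> R_top star \<tau>)
    \<and> x i = (\<Sum>j\<in>{..n} - {i}. s j * x j)"
proof -
  obtain n S where S: "field_topology \<tau>" "top_bounded \<tau> S" "W_set n S"
    using assms unfolding W_topology_def Wn_topology_def by blast
  have "star S \<subseteq> R_top star \<tau>" using R_topI[OF S(1,2)] by blast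
  then have "\<exists>i\<le>n. \<exists>s. (\<forall>j\<in>{..n} - {i}. s j \<in> R_top star \<tau>)
      \<and> x i = (\<Sum>j\<in>{..n} - {i}. s j * x j)" for x :: "nat \<Rightarrow> 'b"
    using S(3) unfolding W_set_star W_set_def by blast
  then show ?thesis by (rule that)
qed

end


section \<open>Independence of the localizations\<close>

text \<open>The family \<open>x\<close> is built one element at a time. The error term \<open>e * a\<close> in the induction
  leaves room for the later elements, which are all chosen in \<open>e A\<close>.\<close>

lemma unbounded_weight:
  fixes R A :: "'b::field set"
  assumes R: "field_subring R" and RA: "R \<subseteq> A"
    and add: "\<And>x y. x \<in> A \<Longrightarrow> y \<in> A \<Longrightarrow> x + y \<in> A" and mult: "\<And>x y. x \<in> A \<Longrightarrow> y \<in> A \<Longrightarrow> x * y \<in> A"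
    and denom: "\<And>x. \<exists>d. d \<noteq> 0 \<and> d \<in> R \<and> d * x \<in> R"
    and nonunit: "e\<^sub>0 \<noteq> 0" "1 / e\<^sub>0 \<notin> A"
    and approx: "\<And>d. d \<noteq> 0 \<Longrightarrow> \<exists>e a. e \<noteq> 0 \<and> a \<in> A \<and> (\<forall>y\<in>R. \<forall>z\<in>A. d * a \<noteq> y + e * z)"
  shows "\<exists>x :: nat \<Rightarrow> 'b. \<forall>i\<le>n. \<forall>s. (\<forall>j\<in>{..n} - {i}. s j \<in> R) \<longrightarrow> x i \<noteq> (\<Sum>j\<in>{..n} - {i}. s j * x j)"
proof -
  interpret field_subring R by (rule R)
  \<comment> \<open>The common denominator \<open>d\<close> turns \<open>R\<close>-combinations of
    the family into elements of \<open>R\<close>.\<close>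
  have "\<exists>(x :: nat \<Rightarrow> 'b) e d. e \<noteq> 0 \<and> d \<noteq> 0 \<and> (\<forall>j\<le>n. d * x j \<in> R)
      \<and> (\<forall>i\<le>n. \<forall>s. \<forall>a\<in>A. (\<forall>j\<in>{..n} - {i}. s j \<in> R) \<longrightarrow> x i \<noteq> (\<Sum>j\<in>{..n} - {i}. s j * x j) + e * a)"
  proof (induction n)
    case 0
    \<comment> \<open>The family starts with the single element \<open>1\<close> and error set
      \<open>e\<^sub>0 A\<close>, which misses \<open>1\<close> because \<open>1 / e\<^sub>0\<close>
      is not in \<open>A\<close>.\<close>
    have "1 \<noteq> e\<^sub>0 * a" if "a \<in> A" for a
      using nonunit that by (metis nonzero_mult_div_cancel_left)
    then show ?case
      using nonunit(1) one_mem by (intro exI[of _ "\<lambda>_. 1"] exI[of _ e\<^sub>0] exI[of _ 1]) auto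
  next
    case (Suc n)
    then obtain x :: "nat \<Rightarrow> 'b" and e d where x: "e \<noteq> 0" "d \<noteq> 0" "\<forall>j\<le>n. d * x j \<in> R"
      "\<forall>i\<le>n. \<forall>s. \<forall>a\<in>A. (\<forall>j\<in>{..n} - {i}. s j \<in> R) \<longrightarrow> x i \<noteq> (\<Sum>j\<in>{..n} - {i}. s j * x j) + e * a"
      by (elim exE conjE) (rule that)
    have "d * e \<noteq> 0" using x(1,2) by simp
    \<comment> \<open>Applied to the scalar \<open>d * e\<close>: the new member will be
      \<open>e * a\<close>, and \<open>d\<close> times it avoids \<open>R + e' A\<close>.\<close>
    then obtain e' a where e': "e' \<noteq> 0" "a \<in> A" "\<forall>y\<in>R. \<forall>z\<in>A. d * e * a \<noteq> y + e' * z"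
      using approx by blast
    \<comment> \<open>The new error factor is \<open>q * e\<close>. As \<open>q\<close> is in
      \<open>R\<close>, errors stay in \<open>e A\<close>; as \<open>q * (d * e / e')\<close> is in
      \<open>R\<close>, \<open>d\<close> times an error lies in \<open>e' A\<close>.\<close>
    obtain q where q: "q \<noteq> 0" "q \<in> R" "q * (d * e / e') \<in> R" using denom by blast
    obtain q' where q': "q' \<noteq> 0" "q' \<in> R" "q' * (d * (e * a)) \<in> R" using denom by blast
    define x' where "x' = x(Suc n := e * a)"
    have den: "q' * d * x' j \<in> R" if "j \<le> Suc n" for j
    proof (cases "j = Suc n")
      case True
      then show ?thesis using q'(3) by (simp add: x'_def mult.assoc)
    next
      case False
      then have "q' * (d * x j) \<in> R" using that x(3) q'(2) mult_mem by simp
      then show ?thesis using False by (simp add: x'_def mult.assoc)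
    qed
    have indep: "x' i \<noteq> (\<Sum>j\<in>{..Suc n} - {i}. s j * x' j) + q * e * b"
      if i: "i \<le> Suc n" and b: "b \<in> A" and s: "\<forall>j\<in>{..Suc n} - {i}. s j \<in> R" for i s b
    proof (cases "i = Suc n")
      case True
      have I: "{..Suc n} - {i} = {..n}" using True by auto
      show ?thesis
      proof
        assume "x' i = (\<Sum>j\<in>{..Suc n} - {i}. s j * x' j) + q * e * b"
        then have "e * a = (\<Sum>j\<le>n. s j * x j) + q * e * b"
          unfolding I using True by (simp add: x'_def)
        \<comment> \<open>Multiplication by \<open>d\<close> moves the combination of the old
          members into \<open>R\<close>, against the choice of \<open>a\<close>.\<close>
        then have "d * e * a = d * (\<Sum>j\<le>n. s j * x j) + d * (q * e * b)"
          by (simp add: distrib_left mult.assoc)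
        also have "\<dots> = (\<Sum>j\<le>n. s j * (d * x j)) + e' * (q * (d * e / e') * b)"
          using e'(1) by (simp add: sum_distrib_left mult_ac)
        finally have "d * e * a = (\<Sum>j\<le>n. s j * (d * x j)) + e' * (q * (d * e / e') * b)" .
        moreover have "(\<Sum>j\<le>n. s j * (d * x j)) \<in> R"
          using s x(3) unfolding I by (intro sum_mem) (simp add: mult_mem)
        moreover have "q * (d * e / e') * b \<in> A" using q(3) b RA mult by blast
        ultimately show False using e'(3) by blast
      qed
    next
      case False
      then have i': "i \<le> n" using i by simp
      have I: "{..Suc n} - {i} = insert (Suc n) ({..n} - {i})" using i' by auto
      \<comment> \<open>The new member and the new error both lie in \<open>e A\<close>, so they
        merge into a single error term for the old family.\<close>
      have "(\<Sum>j\<in>{..Suc n} - {i}. s j * x' j) + q * e * b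
          = (\<Sum>j\<in>{..n} - {i}. s j * x j) + e * (s (Suc n) * a + q * b)"
      proof -
        have "(\<Sum>j\<in>{..n} - {i}. s j * x' j) = (\<Sum>j\<in>{..n} - {i}. s j * x j)"
          by (rule sum.cong) (auto simp: x'_def)
        then show ?thesis unfolding I by (simp add: x'_def algebra_simps)
      qed
      moreover have "s (Suc n) * a + q * b \<in> A"
        using s b e'(2) q(2) RA i' by (intro add mult) auto
      moreover have "\<forall>j\<in>{..n} - {i}. s j \<in> R" using s by auto
      ultimately show ?thesis using x(4) i' False by (simp add: x'_def)
    qed
    show ?case
      using x(1,2) q(1) q'(1) den indep
      by (intro exI[of _ x'] exI[of _ "q * e"] exI[of _ "q' * d"]) simp
  qed
  then obtain x :: "nat \<Rightarrow> 'b" and e where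
    x: "\<forall>i\<le>n. \<forall>s. \<forall>a\<in>A. (\<forall>j\<in>{..n} - {i}. s j \<in> R) \<longrightarrow> x i \<noteq> (\<Sum>j\<in>{..n} - {i}. s j * x j) + e * a"
    by (elim exE conjE) (rule that)
  have "0 \<in> A" using zero_mem RA by blast
  have "x i \<noteq> (\<Sum>j\<in>{..n} - {i}. s j * x j)" if "i \<le> n" "\<forall>j\<in>{..n} - {i}. s j \<in> R" for i s
  proof -
    have "x i \<noteq> (\<Sum>j\<in>{..n} - {i}. s j * x j) + e * 0" using x that \<open>0 \<in> A\<close> by blast
    then show ?thesis by simp
  qed
  then show ?thesis by blast
qed

context saturated_extension
begin

lemma double_localization_eq_UNIV:
  assumes R: "field_subring R"
    and M: "maximalideal M (subring_of R)" and N: "maximalideal N (subring_of R)" and "M \<noteq> N"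
    and \<sigma>: "W_topology \<sigma>" and \<rho>: "field_topology \<rho>"
    and RM: "R_top star \<sigma> = localization R M" and RN: "R_top star \<rho> = localization R N"
  shows "field_subring.double_localization R M N = UNIV"
proof (rule ccontr)
  interpret field_subring R by (rule R)
  define A where "A = double_localization M N"
  have \<sigma>': "field_topology \<sigma>" using \<sigma> by (rule W_topology_imp_field_topology)
  interpret S: field_subring "R_top star \<sigma>" using subring_R_top[OF \<sigma>'] .
  assume "double_localization M N \<noteq> UNIV"
  then obtain w where w: "w \<notin> A" unfolding A_def by blast
  have products: "A = {x * y |x y. x \<in> R_top star \<sigma> \<and> y \<in> R_top star \<rho>}"
    unfolding A_def RM RN by (rule double_localization_eq_products[OF M N])
  have "1 \<in> R_top star \<rho>" using subring_R_top[OF \<rho>] by (rule field_subring.one_mem)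
  then have "x * 1 \<in> A" if "x \<in> R_top star \<sigma>" for x unfolding products using that by blast
  then have sub: "R_top star \<sigma> \<subseteq> A" by auto
  have "w \<noteq> 0" using w sub S.zero_mem by auto
  then have nonunit: "1 / w \<noteq> 0" "1 / (1 / w) \<notin> A" using w by simp_all
  obtain U where U: "nbhd_zero \<sigma> U" "top_bounded \<sigma> U"
    by (rule field_top.bounded_nbhd[OF field_top.intro[OF \<sigma>']])
  obtain V where V: "nbhd_zero \<rho> V" "top_bounded \<rho> V"
    by (rule field_top.bounded_nbhd[OF field_top.intro[OF \<rho>]])
  \<comment> \<open>\<open>C\<close> does for \<open>A\<close> what a bounded neighbourhood does for
    its ring: \<open>star C\<close> lies in \<open>A\<close>, and scalars of the small field bring
    each element of \<open>A\<close> into it.\<close>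
  define C where "C = {u * v |u v. u \<in> U \<and> v \<in> V}"
  have starC: "star C = {x * y |x y. x \<in> star U \<and> y \<in> star V}"
    unfolding C_def by (rule star_products)
  have CA: "star C \<subseteq> A" unfolding starC products using R_topI[OF \<sigma>' U(2)] R_topI[OF \<rho> V(2)] by blast
  have AC: "\<exists>c. c \<noteq> 0 \<and> \<iota> c * x \<in> star C" if "x \<in> A" for x
  proof -
    obtain u v where uv: "x = u * v" "u \<in> R_top star \<sigma>" "v \<in> R_top star \<rho>"
      using \<open>x \<in> A\<close> unfolding products by blast
    obtain c d where "c \<noteq> 0" "d \<noteq> 0" "\<iota> c * u \<in> star U" "\<iota> d * v \<in> star V"
      using uv R_top_iff[OF \<sigma>' U] R_top_iff[OF \<rho> V] by blast
    then have "c * d \<noteq> 0" "\<iota> (c * d) * x = (\<iota> c * u) * (\<iota> d * v)"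
      using uv(1) by (simp_all add: iota_mult mult_ac)
    then show ?thesis unfolding starC using \<open>\<iota> c * u \<in> star U\<close> \<open>\<iota> d * v \<in> star V\<close> by blast
  qed
  obtain \<epsilon> where \<epsilon>: "\<epsilon> \<noteq> 0" "\<forall>x\<in>R_top star \<sigma>. \<epsilon> * x \<in> star U"
    by (rule infinitesimal[OF \<sigma>' U(1)])
  have \<epsilon>A: "\<epsilon> * x \<in> star C" if "x \<in> A" for x
  proof -
    obtain u v where uv: "x = u * v" "u \<in> R_top star \<sigma>" "v \<in> R_top star \<rho>"
      using \<open>x \<in> A\<close> unfolding products by blast
    \<comment> \<open>The scalar bringing \<open>v\<close> into \<open>star V\<close> depends on
      \<open>v\<close>. Its inverse is absorbed by \<open>u\<close>, which stays in the ring that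
      \<open>\<epsilon>\<close> handles uniformly.\<close>
    obtain c where c: "c \<noteq> 0" "\<iota> c * v \<in> star V" using uv R_top_iff[OF \<rho> V] by blast
    have "\<iota> (inverse c) * u \<in> R_top star \<sigma>" using S.mult_mem iota_mem_R_top[OF \<sigma>'] uv(2) by blast
    then have "\<epsilon> * (\<iota> (inverse c) * u) \<in> star U" using \<epsilon>(2) by blast
    moreover have "\<epsilon> * x = (\<epsilon> * (\<iota> (inverse c) * u)) * (\<iota> c * v)"
      using uv(1) c(1) by (simp add: iota_inverse)
    ultimately show ?thesis unfolding starC using c(2) by blast
  qed
  have approx: "\<exists>e a. e \<noteq> 0 \<and> a \<in> A \<and> (\<forall>y\<in>R_top star \<sigma>. \<forall>z\<in>A. d * a \<noteq> y + e * z)" if "d \<noteq> 0" for d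
  proof (rule ccontr)
    assume "\<not> (\<exists>e a. e \<noteq> 0 \<and> a \<in> A \<and> (\<forall>y\<in>R_top star \<sigma>. \<forall>z\<in>A. d * a \<noteq> y + e * z))"
    then have neg: "\<exists>y\<in>R_top star \<sigma>. \<exists>z\<in>A. d * a = y + e * z" if "e \<noteq> 0" "a \<in> A" for e a
      using that by blast
    have "\<epsilon> * d \<noteq> 0" using \<epsilon>(1) \<open>d \<noteq> 0\<close> by simp
    \<comment> \<open>Multiplying \<open>d * x = y + e * z\<close> by \<open>\<epsilon>\<close>
      moves \<open>y\<close> into \<open>star U\<close> and \<open>z\<close> into
      \<open>star C\<close> and leaves \<open>e\<close> unchanged; the inclusion becomes
      first-order.\<close>
    moreover have "\<exists>y\<in>star U. \<exists>z\<in>star C. \<epsilon> * d * x = y + e * z" if "e \<noteq> 0" "x \<in> star C" for e x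
    proof -
      obtain y z where yz: "y \<in> R_top star \<sigma>" "z \<in> A" "d * x = y + e * z"
        using neg[OF \<open>e \<noteq> 0\<close>] \<open>x \<in> star C\<close> CA by blast
      have "\<epsilon> * d * x = \<epsilon> * (d * x)" by (simp add: mult.assoc)
      also have "\<dots> = \<epsilon> * y + e * (\<epsilon> * z)" unfolding yz(3) by (simp add: distrib_left mult.left_commute)
      finally show ?thesis using \<epsilon>(2) yz(1) \<epsilon>A[OF yz(2)] by blast
    qed
    ultimately obtain c where c: "c \<noteq> 0"
      "\<forall>e x. e \<noteq> 0 \<longrightarrow> x \<in> star C \<longrightarrow> (\<exists>y\<in>star U. \<exists>z\<in>star C. \<iota> c * x = y + e * z)"
      by (rule scaled_approximation_reflect)
    \<comment> \<open>This \<open>x\<close> contradicts the descended inclusion at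
      \<open>e = 1 / w\<close>: the scalars \<open>c\<close> and \<open>b\<close> come from the
      small field, so they can be divided out again.\<close>
    obtain x where x: "x \<in> A" "\<forall>y\<in>R_top star \<sigma>. \<forall>z\<in>A. x \<noteq> y + (1 / w) * z"
      unfolding RM A_def
      by (rule double_localization_not_subset[OF M N \<open>M \<noteq> N\<close> nonunit[unfolded A_def]])
    obtain b where b: "b \<noteq> 0" "\<iota> b * x \<in> star C" using AC x(1) by blast
    obtain y z where yz: "y \<in> star U" "z \<in> star C" "\<iota> c * (\<iota> b * x) = y + (1 / w) * z"
      using c(2) nonunit(1) b(2) by blast
    define k where "k = \<iota> (inverse (c * b))"
    have kR: "k \<in> R_top star \<sigma>" unfolding k_def by (rule iota_mem_R_top[OF \<sigma>'])
    have "inverse (c * b) * (c * b) = 1" using b(1) c(1) by (intro left_inverse) simp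
    then have "k * (\<iota> c * \<iota> b) = 1" unfolding k_def iota_mult[symmetric] by simp
    then have "x = k * (\<iota> c * (\<iota> b * x))" by (metis mult.assoc mult.left_neutral)
    also have "\<dots> = k * y + (1 / w) * (k * z)" unfolding yz(3) by (simp add: algebra_simps)
    finally have "x = k * y + (1 / w) * (k * z)" .
    moreover have "k * y \<in> R_top star \<sigma>" using kR S.mult_mem R_topI[OF \<sigma>' U(2) yz(1)] by blast
    moreover have "k * z \<in> A"
      using double_localization_mult[OF M N] kR sub CA yz(2) unfolding A_def by blast
    ultimately show False using x(2) by blast
  qed
  obtain n where n: "\<And>x :: nat \<Rightarrow> 'b. \<exists>i\<le>n. \<exists>s. (\<forall>j\<in>{..n} - {i}. s j \<in> R_top star \<sigma>)
    \<and> x i = (\<Sum>j\<in>{..n} - {i}. s j * x j)"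
    using W_topology_R_top[OF \<sigma>] by metis
  have "\<exists>x :: nat \<Rightarrow> 'b. \<forall>i\<le>n. \<forall>s. (\<forall>j\<in>{..n} - {i}. s j \<in> R_top star \<sigma>)
      \<longrightarrow> x i \<noteq> (\<Sum>j\<in>{..n} - {i}. s j * x j)"
    by (rule unbounded_weight[OF S.field_subring_axioms sub _ _ common_denominator_R_top[OF \<sigma>'] nonunit approx])
      (simp_all add: A_def double_localization_add[OF M N] double_localization_mult[OF M N])
  then show False using n by metis
qed

end

section \<open>Weak approximation\<close>

context field_subring
begin

text \<open>Chinese remainders for the ideals \<open>Q j\<close>: modulo these, \<open>u\<close> is
  \<open>1\<close> at \<open>i\<close> and \<open>0\<close> elsewhere. It suffices that no maximal
  ideal contains both \<open>Q i\<close> and the intersection of the others.\<close>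

lemma exists_approximate_idempotent:
  fixes M :: "nat \<Rightarrow> 'b set" and e :: "nat \<Rightarrow> 'b"
  assumes M: "\<And>i. i < n \<Longrightarrow> maximalideal (M i) (subring_of R)"
    and all: "\<And>N. maximalideal N (subring_of R) \<Longrightarrow> \<exists>i<n. N = M i"
    and sub: "\<And>i. i < n \<Longrightarrow> field_subring (localization R (M i))"
    and indep: "\<And>i j. i < n \<Longrightarrow> j < n \<Longrightarrow> i \<noteq> j \<Longrightarrow> double_localization (M i) (M j) = UNIV"
    and e: "\<And>i. i < n \<Longrightarrow> e i \<noteq> 0"
    and i: "i < n"
  shows "\<exists>u. (u - 1) / e i \<in> localization R (M i) \<and> (\<forall>j<n. j \<noteq> i \<longrightarrow> u / e j \<in> localization R (M j))"
proof -
  define Q where "Q j = {r \<in> R. r / e j \<in> localization R (M j)}" for j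
  have Q_ideal: "ideal (Q j) (subring_of R)" if j: "j < n" for j
  proof -
    interpret L: field_subring "localization R (M j)" by (rule sub[OF j])
    have "r * x / e j \<in> localization R (M j)" if "r \<in> R" "x / e j \<in> localization R (M j)" for r x
      using L.mult_mem[of r "x / e j"] that subset_localization[OF M[OF j]] by auto
    then show ?thesis
      unfolding ideal_subring_of_iff Q_def
      using zero_mem L.zero_mem add_mem L.add_mem mult_mem by (auto simp: add_divide_distrib)
  qed
  have Q_mem: "0 \<in> Q j" "\<And>x y. x \<in> Q j \<Longrightarrow> y \<in> Q j \<Longrightarrow> x + y \<in> Q j"
    "\<And>r x. r \<in> R \<Longrightarrow> x \<in> Q j \<Longrightarrow> r * x \<in> Q j" if "j < n" for j
    using Q_ideal[OF that] unfolding ideal_subring_of_iff by blast+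
  have Q_not_subset: "\<exists>t. t \<in> Q j \<and> t \<in> R - M k" if jk: "j < n" "k < n" "j \<noteq> k" for j k
  proof -
    \<comment> \<open>Independence splits the denominator of \<open>1 / e j\<close> into
      \<open>s\<close> outside \<open>M j\<close> and \<open>t\<close> outside \<open>M k\<close>;
      then \<open>t / e j = a / s\<close> puts \<open>t\<close> into \<open>Q j\<close>.\<close>
    have "1 / e j \<in> double_localization (M j) (M k)" using indep[OF jk] by simp
    then obtain a s t where *: "a \<in> R" "s \<in> R - M j" "t \<in> R - M k" "1 / e j = a / (s * t)"
      by (rule double_localizationE)
    have "s \<noteq> 0" "t \<noteq> 0" using * maximalideal_zero M jk by auto
    then have "t / e j = a / s" using *(4) e[OF jk(1)] by (simp add: field_simps)
    then have "t \<in> Q j" unfolding Q_def using * localizationI[OF M[OF jk(1)]] by simp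
    then show ?thesis using *(3) by blast
  qed
  \<comment> \<open>The intersection with \<open>R\<close> matters for \<open>n = 1\<close>, where
    the index set is empty and its intersection is the whole type.\<close>
  define J where "J = (\<Inter>j\<in>{..<n} - {i}. Q j) \<inter> R"
  define I where "I = {x + y |x y. x \<in> Q i \<and> y \<in> J}"
  have J_mem: "0 \<in> J" "\<And>x y. x \<in> J \<Longrightarrow> y \<in> J \<Longrightarrow> x + y \<in> J" "\<And>r x. r \<in> R \<Longrightarrow> x \<in> J \<Longrightarrow> r * x \<in> J"
    unfolding J_def using Q_mem zero_mem add_mem mult_mem by auto
  have I_ideal: "ideal I (subring_of R)"
    unfolding ideal_subring_of_iff
  proof (intro conjI ballI)
    show "I \<subseteq> R" unfolding I_def Q_def J_def using add_mem by auto
    show "0 \<in> I" unfolding I_def using Q_mem(1)[OF i] J_mem(1) by force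
    show "x + y \<in> I" if xy: "x \<in> I" "y \<in> I" for x y
    proof -
      obtain a b a' b' where *: "x = a + b" "y = a' + b'" "a \<in> Q i" "a' \<in> Q i" "b \<in> J" "b' \<in> J"
        using xy unfolding I_def by blast
      have "x + y = (a + a') + (b + b')" using * by (simp add: algebra_simps)
      then show ?thesis unfolding I_def using Q_mem(2)[OF i] J_mem(2) * by blast
    qed
    show "r * x \<in> I" if "r \<in> R" "x \<in> I" for r x
    proof -
      obtain a b where *: "x = a + b" "a \<in> Q i" "b \<in> J" using \<open>x \<in> I\<close> unfolding I_def by blast
      have "r * x = r * a + r * b" using * by (simp add: distrib_left)
      then show ?thesis unfolding I_def using Q_mem(3)[OF i] J_mem(3) * \<open>r \<in> R\<close> by blast
    qed
  qed
  have "1 \<in> I"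
  proof (rule ccontr)
    assume "1 \<notin> I"
    then obtain N where N: "maximalideal N (subring_of R)" "I \<subseteq> N"
      using exists_maximalideal[OF I_ideal] by blast
    then obtain k where k: "k < n" "N = M k" using all by blast
    have QN: "Q i \<subseteq> N" and JN: "J \<subseteq> N"
      using N(2) Q_mem(1)[OF i] J_mem(1) unfolding I_def by force+
    show False
    proof (cases "k = i")
      case False
      then show False using Q_not_subset[OF i k(1)] QN k(2) by blast
    next
      case True
      have "\<forall>j\<in>{..<n} - {i}. \<exists>t. t \<in> Q j \<and> t \<in> R - M i" using Q_not_subset i by blast
      then obtain t where t: "\<And>j. j \<in> {..<n} - {i} \<Longrightarrow> t j \<in> Q j \<and> t j \<in> R - M i" by metis
      \<comment> \<open>One factor from each other ideal puts the product into \<open>J\<close>; as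
        \<open>M i\<close> is prime, it stays outside \<open>M i\<close>.\<close>
      let ?p = "prod t ({..<n} - {i})"
      have "?p \<in> R - M i" by (rule maximalideal_prod_notin[OF M[OF i]]) (use t in auto)
      moreover have "?p \<in> Q j" if j: "j \<in> {..<n} - {i}" for j
      proof -
        have "?p = prod t ({..<n} - {i} - {j}) * t j"
          using j by (simp add: prod.remove mult.commute)
        moreover have "prod t ({..<n} - {i} - {j}) \<in> R" by (rule prod_mem) (use t in auto)
        ultimately show ?thesis using Q_mem(3) t[OF j] j by simp
      qed
      ultimately show False using JN k(2) True unfolding J_def by blast
    qed
  qed
  then obtain x y where xy: "1 = x + y" "x \<in> Q i" "y \<in> J" unfolding I_def by blast
  show ?thesis
  proof (intro exI conjI)
    have "y - 1 = - x" unfolding xy(1) by simp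
    then show "(y - 1) / e i \<in> localization R (M i)"
      using xy(2) field_subring.uminus_mem[OF sub[OF i]] unfolding Q_def by simp
    show "\<forall>j<n. j \<noteq> i \<longrightarrow> y / e j \<in> localization R (M j)"
      using xy(3) unfolding J_def Q_def by blast
  qed
qed

text \<open>The solution is \<open>\<Sum>j<n. a j * u j\<close> with the approximate idempotents
  \<open>u j\<close>. The errors stay small because every \<open>a j\<close> lies in every
  localization.\<close>

lemma weak_approximation:
  fixes M :: "nat \<Rightarrow> 'b set" and e a :: "nat \<Rightarrow> 'b"
  assumes M: "\<And>i. i < n \<Longrightarrow> maximalideal (M i) (subring_of R)"
    and all: "\<And>N. maximalideal N (subring_of R) \<Longrightarrow> \<exists>i<n. N = M i"
    and sub: "\<And>i. i < n \<Longrightarrow> field_subring (localization R (M i))"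
    and indep: "\<And>i j. i < n \<Longrightarrow> j < n \<Longrightarrow> i \<noteq> j \<Longrightarrow> double_localization (M i) (M j) = UNIV"
    and e: "\<And>i. i < n \<Longrightarrow> e i \<noteq> 0"
    and a: "\<And>i j. i < n \<Longrightarrow> j < n \<Longrightarrow> a j \<in> localization R (M i)"
  obtains x where "\<forall>i<n. (x - a i) / e i \<in> localization R (M i)"
proof -
  have "\<exists>u. (u - 1) / e i \<in> localization R (M i)
      \<and> (\<forall>j<n. j \<noteq> i \<longrightarrow> u / e j \<in> localization R (M j))" if "i < n" for i
    by (rule exists_approximate_idempotent[of n M e i]) (use M all sub indep e that in auto)
  then obtain u where u: "\<And>i. i < n \<Longrightarrow> (u i - 1) / e i \<in> localization R (M i)"
    "\<And>i j. i < n \<Longrightarrow> j < n \<Longrightarrow> j \<noteq> i \<Longrightarrow> u i / e j \<in> localization R (M j)"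
    by metis
  have "((\<Sum>j<n. a j * u j) - a i) / e i \<in> localization R (M i)" if i: "i < n" for i
  proof -
    interpret L: field_subring "localization R (M i)" by (rule sub[OF i])
    have "(\<Sum>j<n. a j * u j) - a i = a i * (u i - 1) + (\<Sum>j\<in>{..<n} - {i}. a j * u j)"
      using i by (subst sum.remove[of _ i]) (auto simp: algebra_simps)
    then have "((\<Sum>j<n. a j * u j) - a i) / e i
        = a i * ((u i - 1) / e i) + (\<Sum>j\<in>{..<n} - {i}. a j * (u j / e i))"
      by (simp add: add_divide_distrib sum_divide_distrib)
    also have "\<dots> \<in> localization R (M i)"
      using u a i by (intro L.add_mem L.sum_mem L.mult_mem) auto
    finally show ?thesis .
  qed
  then show ?thesis using that by blast
qed

end


section \<open>Independent sums\<close>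

text \<open>Translation reduces the embedding to neighbourhoods of zero: \<open>coarser\<close>
  gives continuity of the diagonal, \<open>finer\<close> gives openness onto the image, and
  \<open>dense\<close> says that the image meets every nonempty open box.\<close>

lemma independent_sumI:
  fixes T :: "nat \<Rightarrow> 'a::field topology"
  assumes \<tau>: "field_topology \<tau>" and T: "\<And>i. i < n \<Longrightarrow> field_topology (T i)" and n: "n > 0"
    and coarser: "\<And>i V. i < n \<Longrightarrow> nbhd_zero (T i) V \<Longrightarrow> nbhd_zero \<tau> V"
    and finer: "\<And>V. nbhd_zero \<tau> V \<Longrightarrow> \<exists>U. (\<forall>i<n. nbhd_zero (T i) (U i)) \<and> (\<Inter>i<n. U i) \<subseteq> V"
    and dense: "\<And>U a. (\<And>i. i < n \<Longrightarrow> openin (T i) (U i)) \<Longrightarrow> (\<And>i. i < n \<Longrightarrow> a i \<in> U i) \<Longrightarrow> (\<Inter>i<n. U i) \<noteq> {}"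
  shows "independent_sum \<tau> n T"
proof -
  let ?P = "product_topology T {..<n}"
  interpret X: field_top \<tau> by unfold_locales (rule \<tau>)
  have FT: "field_top (T i)" if "i < n" for i using T[OF that] by unfold_locales
  have diag: "diagonal n x i = x" if "i < n" for x :: 'a and i
    using that by (simp add: diagonal_def)
  have range_diag: "diagonal n x \<in> PiE {..<n} S \<longleftrightarrow> (\<forall>i<n. x \<in> S i)" for x and S :: "nat \<Rightarrow> 'a set"
    by (auto simp: diagonal_def PiE_def Pi_def)
  \<comment> \<open>Coordinate \<open>0\<close> separates points; it exists because
    \<open>n > 0\<close>.\<close>
  have inj: "inj (diagonal n :: 'a \<Rightarrow> _)"
    using diag[OF n] by (metis injI)
  have cont: "continuous_map \<tau> ?P (diagonal n)"
    unfolding continuous_map_componentwise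
  proof (intro conjI ballI)
    show "diagonal n ` topspace \<tau> \<subseteq> extensional {..<n}" by (auto simp: diagonal_def)
    fix i assume "i \<in> {..<n}"
    then have i: "i < n" by simp
    have "openin \<tau> W" if "openin (T i) W" for W
      using that coarser[OF i] unfolding X.openin_iff_nbhd field_top.openin_iff_nbhd[OF FT[OF i]] by blast
    then show "continuous_map \<tau> (T i) (\<lambda>x. diagonal n x i)"
      using diag[OF i] field_top.topspace_UNIV[OF FT[OF i]] X.topspace_UNIV by (simp add: continuous_map_def)
  qed
  have "open_map \<tau> (subtopology ?P (diagonal n ` topspace \<tau>)) (diagonal n)"
    unfolding open_map_def
  proof (intro allI impI)
    fix W assume W: "openin \<tau> W"
    show "openin (subtopology ?P (diagonal n ` topspace \<tau>)) (diagonal n ` W)"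
    proof (subst openin_subopen, intro ballI)
      fix f assume "f \<in> diagonal n ` W"
      then obtain x where x: "x \<in> W" "f = diagonal n x" by blast
      then have "nbhd_zero \<tau> {y. x + y \<in> W}" using W unfolding X.openin_iff_nbhd by blast
      then obtain U where U: "\<forall>i<n. nbhd_zero (T i) (U i)" "(\<Inter>i<n. U i) \<subseteq> {y. x + y \<in> W}"
        using finer by blast
      have "\<exists>G. openin (T i) G \<and> 0 \<in> G \<and> G \<subseteq> U i" if "i < n" for i
        using U(1) that unfolding nbhd_zero_def by blast
      then obtain G where G: "\<And>i. i < n \<Longrightarrow> openin (T i) (G i) \<and> 0 \<in> G i \<and> G i \<subseteq> U i" by metis
      define G' where "G' i = {y. - x + y \<in> G i}" for i
      have "openin (T i) (G' i)" if "i < n" for i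
        unfolding G'_def using field_top.openin_translation[OF FT[OF that]] G[OF that] by blast
      then have "openin ?P (PiE {..<n} G')" by (simp add: openin_PiE_gen)
      moreover have "f \<in> PiE {..<n} G'" unfolding x(2) range_diag G'_def using G by simp
      moreover have "PiE {..<n} G' \<inter> diagonal n ` topspace \<tau> \<subseteq> diagonal n ` W"
      proof
        fix g assume "g \<in> PiE {..<n} G' \<inter> diagonal n ` topspace \<tau>"
        then obtain y where y: "g = diagonal n y" "\<forall>i<n. y \<in> G' i" using range_diag by blast
        have "- x + y \<in> (\<Inter>i<n. U i)" using y(2) G unfolding G'_def by blast
        then have "x + (- x + y) \<in> W" using U(2) by blast
        then show "g \<in> diagonal n ` W" using y(1) by simp
      qed
      ultimately show "\<exists>S. openin (subtopology ?P (diagonal n ` topspace \<tau>)) S \<and> f \<in> S \<and> S \<subseteq> diagonal n ` W"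
        using x(2) X.topspace_UNIV unfolding openin_subtopology
        by (intro exI[of _ "PiE {..<n} G' \<inter> diagonal n ` topspace \<tau>"]) auto
    qed
  qed
  moreover have "continuous_map \<tau> (subtopology ?P (diagonal n ` topspace \<tau>)) (diagonal n)"
    using cont by (simp add: continuous_map_in_subtopology)
  moreover have "diagonal n ` topspace \<tau> = topspace (subtopology ?P (diagonal n ` topspace \<tau>))"
    using continuous_map_image_subset_topspace[OF cont]
    by (simp only: topspace_subtopology Int_absorb1)
  moreover have "inj_on (diagonal n) (topspace \<tau>)" using inj by (rule inj_on_subset) simp
  ultimately have "embedding_map \<tau> ?P (diagonal n)"
    unfolding embedding_map_def by (metis bijective_open_imp_homeomorphic_map)
  moreover have "?P closure_of (diagonal n ` topspace \<tau>) = topspace ?P"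
    unfolding dense_intersects_open
  proof (intro allI impI)
    fix S assume S: "openin ?P S \<and> S \<noteq> {}"
    then obtain a where a: "a \<in> S" by blast
    then obtain U where U: "\<forall>i\<in>{..<n}. openin (T i) (U i)" "a \<in> PiE {..<n} U" "PiE {..<n} U \<subseteq> S"
      using S unfolding openin_product_topology_alt by blast
    have "(\<Inter>i<n. U i) \<noteq> {}" by (rule dense[of U a]) (use U in \<open>auto simp: PiE_iff\<close>)
    then obtain z where "\<forall>i<n. z \<in> U i" by blast
    then have "diagonal n z \<in> S" using U(3) range_diag by blast
    then show "diagonal n ` topspace \<tau> \<inter> S \<noteq> {}" using X.topspace_UNIV by blast
  qed
  ultimately show ?thesis unfolding independent_sum_def by blast
qed

section \<open>The local components of a W-topology\<close>

theorem theorem4p12: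
  fixes \<tau> :: "'a::field topology" and T :: "nat \<Rightarrow> 'a topology" and n :: nat
    and \<iota> :: "'a \<Rightarrow> 'b::field" and star :: "'a set \<Rightarrow> 'b set"
  assumes "monster_model \<iota> star"
    and "W_topology \<tau>"
    and "local_components star \<tau> n T"
  shows "independent_sum \<tau> n T"
proof -
  interpret saturated_extension \<iota> star
    using assms(1) unfolding monster_model_def by unfold_locales blast+
  have \<tau>: "field_topology \<tau>" by (rule W_topology_imp_field_topology) fact
  have W: "W_topology (T i)" if "i < n" for i
    using assms(3) that unfolding local_components_def by blast
  note T = W_topology_imp_field_topology[OF W]
  define R where "R = R_top star \<tau>"
  interpret field_subring R unfolding R_def by (rule subring_R_top[OF \<tau>])
  have components: "{R_top star (T i) |i. i < n} = {localization R M |M. maximalideal M (subring_of R)}"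
    using assms(3) unfolding local_components_def R_def by blast
  have "\<exists>M. maximalideal M (subring_of R) \<and> R_top star (T i) = localization R M" if "i < n" for i
    using components that by blast
  then obtain M where M: "\<And>i. i < n \<Longrightarrow> maximalideal (M i) (subring_of R)"
    and RT: "\<And>i. i < n \<Longrightarrow> R_top star (T i) = localization R (M i)" by metis
  have all: "\<exists>i<n. N = M i" if N: "maximalideal N (subring_of R)" for N
  proof -
    have "localization R N \<in> {R_top star (T i) |i. i < n}" unfolding components using N by blast
    then obtain i where i: "i < n" "localization R N = R_top star (T i)" by blast
    then show ?thesis using maximalideal_eq_if_localization_eq[OF N M[OF i(1)]] RT[OF i(1)] by auto
  qed
  \<comment> \<open>The components are listed without repetition and each is determined by its ring,
    so the maximal ideals are not repeated either.\<close>
  have M_inj: "M i \<noteq> M j" if ij: "i < n" "j < n" "i \<noteq> j" for i j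
  proof
    assume "M i = M j"
    then have "R_top star (T i) = R_top star (T j)" using RT ij by simp
    then have "T i = T j" using R_top_inject[OF T[OF ij(1)] T[OF ij(2)]] by blast
    then show False using assms(3) ij unfolding local_components_def inj_on_def by blast
  qed
  show ?thesis
  proof (rule independent_sumI)
    \<comment> \<open>The zero ideal lies in some maximal ideal, so there is at least one
      component.\<close>
    have "ideal {0} (subring_of R)" unfolding ideal_subring_of_iff using zero_mem by simp
    then obtain N where "maximalideal N (subring_of R)"
      by (rule exists_maximalideal[of "{0}"]) simp_all
    then show "n > 0" using all by force
  next
    fix i V assume i: "i < n" and "nbhd_zero (T i) V"
    then obtain e where "e \<noteq> 0" "\<forall>x\<in>R_top star (T i). e * x \<in> star V"
      using nbhd_zero_iff_R_top[OF T[OF i]] by blast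
    \<comment> \<open>A larger ring means a coarser topology: the multiplier \<open>e\<close> for
      the localization also serves \<open>R\<close>.\<close>
    moreover have "R \<subseteq> R_top star (T i)" unfolding RT[OF i] by (rule subset_localization[OF M[OF i]])
    ultimately show "nbhd_zero \<tau> V" unfolding nbhd_zero_iff_R_top[OF \<tau>] R_def[symmetric] by blast
  next
    fix V assume "nbhd_zero \<tau> V"
    then obtain e where e: "e \<noteq> 0" "\<forall>x\<in>R. e * x \<in> star V"
      unfolding nbhd_zero_iff_R_top[OF \<tau>] R_def[symmetric] by blast
    have "\<exists>B. nbhd_zero (T i) B \<and> top_bounded (T i) B" if "i < n" for i
      using T[OF that] unfolding field_topology_def locally_bounded_def by blast
    then obtain B where B: "\<And>i. i < n \<Longrightarrow> nbhd_zero (T i) (B i) \<and> top_bounded (T i) (B i)" by metis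
    \<comment> \<open>A point of every \<open>star (B i)\<close> lies in every localization, hence
      in \<open>R\<close>. So \<open>e\<close> carries the star of the intersection into
      \<open>star V\<close> and can be replaced by a scalar of the small field.\<close>
    have "star (\<Inter>i<n. B i) \<subseteq> R"
    proof
      fix x assume x: "x \<in> star (\<Inter>i<n. B i)"
      show "x \<in> R"
      proof (rule mem_if_mem_localizations)
        fix N assume "maximalideal N (subring_of R)"
        then obtain i where i: "i < n" "N = M i" using all by blast
        have "x \<in> star (B i)" using x i(1) unfolding star_INT by blast
        then show "x \<in> localization R N"
          using R_topI[OF T[OF i(1)]] B[OF i(1)] RT[OF i(1)] i(2) by blast
      qed
    qed
    then obtain a where a: "a \<noteq> 0" "\<forall>x\<in>(\<Inter>i<n. B i). a * x \<in> V"
      using scale_into_reflect[OF e(1)] e(2) by (metis subsetD)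
    show "\<exists>U. (\<forall>i<n. nbhd_zero (T i) (U i)) \<and> (\<Inter>i<n. U i) \<subseteq> V"
    proof (intro exI conjI allI impI)
      show "nbhd_zero (T i) {x. inverse a * x \<in> B i}" if "i < n" for i
        using field_top.nbhd_zero_scale[OF field_top.intro[OF T[OF that]]] B[OF that] by blast
      show "(\<Inter>i<n. {x. inverse a * x \<in> B i}) \<subseteq> V"
      proof
        fix x assume "x \<in> (\<Inter>i<n. {x. inverse a * x \<in> B i})"
        then have "inverse a * x \<in> (\<Inter>i<n. B i)" by blast
        then have "a * (inverse a * x) \<in> V" using a(2) by blast
        then show "x \<in> V" using a(1) by (simp add: mult.assoc[symmetric])
      qed
    qed
  next
    fix U a assume U: "\<And>i. i < n \<Longrightarrow> openin (T i) (U i)" and a: "\<And>i. i < n \<Longrightarrow> (a i :: 'a) \<in> U i"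
    \<comment> \<open>\<open>e i\<close> measures closeness at \<open>i\<close>: if
      \<open>(x - \<iota> (a i)) / e i\<close> lies in the localization at \<open>M i\<close>, then
      \<open>x\<close> lies in \<open>star (U i)\<close>.\<close>
    have "\<exists>e. e \<noteq> 0 \<and> (\<forall>x\<in>R_top star (T i). e * x \<in> star {y. a i + y \<in> U i})" if i: "i < n" for i
      using U[OF i] a[OF i] unfolding field_top.openin_iff_nbhd[OF field_top.intro[OF T[OF i]]]
        nbhd_zero_iff_R_top[OF T[OF i]] by blast
    then obtain e where e: "\<And>i. i < n \<Longrightarrow> e i \<noteq> 0"
      "\<And>i. i < n \<Longrightarrow> \<forall>x\<in>R_top star (T i). e i * x \<in> star {y. a i + y \<in> U i}" by metis
    obtain x where x: "\<forall>i<n. (x - \<iota> (a i)) / e i \<in> localization R (M i)"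
    proof (rule weak_approximation[of n M e "\<lambda>i. \<iota> (a i)"])
      fix i j assume ij: "i < n" "j < n" "i \<noteq> j"
      show "double_localization (M i) (M j) = UNIV"
        using double_localization_eq_UNIV[OF field_subring_axioms M[OF ij(1)] M[OF ij(2)] M_inj[OF ij]
            W[OF ij(1)] T[OF ij(2)] RT[OF ij(1)] RT[OF ij(2)]] .
    next
      fix i assume i: "i < n"
      show "field_subring (localization R (M i))"
        using subring_R_top[OF T[OF i]] unfolding RT[OF i] .
      show "\<iota> (a j) \<in> localization R (M i)" for j
        using iota_mem_R_top[OF T[OF i]] unfolding RT[OF i] .
    qed (use M all e(1) in blast)+
    have "x \<in> star (U i)" if i: "i < n" for i
    proof -
      have "e i * ((x - \<iota> (a i)) / e i) \<in> star {y. a i + y \<in> U i}"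
        using x e(2)[OF i] i unfolding RT[OF i] by blast
      then show ?thesis unfolding star_translate using e(1)[OF i] by simp
    qed
    then have "x \<in> star (\<Inter>i<n. U i)" unfolding star_INT by blast
    then show "(\<Inter>i<n. U i) \<noteq> {}" by (rule star_nonempty)
  qed (use \<tau> T in blast)+
qed

end
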